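(* Let $N\ge 1$ be an integer, $p>1$, $q=\frac{2p}{p+1}$, and $$M_0:=\left(6N(p+1)\right)^{\frac{p}{p+1}}\left(\frac{p+1}{p-1}\right)^{1/2}.$$ For any $M\ge M_0$ there exists a constant $C=C(N,M,p)>0$ such that, for all $x_0\in\mathbb{R}^N$, $R,T>0$ and every constant $b\ge 1$, every nonnegative solution $u$ of $$u_t-\Delta u=u^p+M|\nabla u|^q\quad\text{in } Q_{T,R}$$ satisfying $u\le b$ and $u_t\le 0$ in $Q_{T,R}$ satisfies $$|\nabla u(x,t)|\le C\,b\left(R^{-1}+R^{-\frac{p+1}{p-1}}+t^{-\frac{p+1}{2p}}\right)\quad\text{in } Q_{T,R/2}.$$
   Context: For $x_0\in\mathbb{R}^N$ and $R,T>0$, $Q_{T,R}=B(x_0,R)\times(0,T)$, where $B(x_0,R)$ is the open ball of $\mathbb{R}^N$; $Q_{T,R/2}$ has the same center $x_0$. The operators $\nabla$ and $\Delta$ act only on the spatial variable $x$. A solution is a classical solution, i.e. it belongs to $C^{2,1}(Q_{T,R})$ ($C^2$ in $x$, $C^1$ in $t$). *)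

theory Defs
  imports "HOL-Analysis.Analysis"
begin

definition parabolic_cylinder :: "real ^ 'n \<Rightarrow> real \<Rightarrow> real \<Rightarrow> ((real ^ 'n) \<times> real) set" where
  "parabolic_cylinder x0 T R = ball x0 R \<times> {0<..<T}"

(* The derivatives below are built from the total operator deriv; the value at a point is
   meaningful where the corresponding one-variable function is differentiable, which C21_on
   guarantees. *)

definition dt :: "(real ^ 'n \<Rightarrow> real \<Rightarrow> real) \<Rightarrow> real ^ 'n \<Rightarrow> real \<Rightarrow> real" where
  "dt u x t = deriv (\<lambda>s. u x s) t"

definition dx :: "'n \<Rightarrow> (real ^ 'n \<Rightarrow> real \<Rightarrow> real) \<Rightarrow> real ^ 'n \<Rightarrow> real \<Rightarrow> real" where
  "dx i u x t = deriv (\<lambda>s. u (x + s *\<^sub>R axis i 1) t) 0"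

definition grad :: "(real ^ 'n \<Rightarrow> real \<Rightarrow> real) \<Rightarrow> real ^ 'n \<Rightarrow> real \<Rightarrow> real ^ 'n" where
  "grad u x t = (\<chi> i. dx i u x t)"

definition laplacian :: "(real ^ 'n \<Rightarrow> real \<Rightarrow> real) \<Rightarrow> real ^ 'n \<Rightarrow> real \<Rightarrow> real" where
  "laplacian u x t = (\<Sum>i\<in>UNIV. dx i (dx i u) x t)"

definition has_dt :: "(real ^ 'n \<Rightarrow> real \<Rightarrow> real) \<Rightarrow> real ^ 'n \<Rightarrow> real \<Rightarrow> bool" where
  "has_dt u x t \<longleftrightarrow> (\<lambda>s. u x s) field_differentiable (at t)"

definition has_dx :: "'n \<Rightarrow> (real ^ 'n \<Rightarrow> real \<Rightarrow> real) \<Rightarrow> real ^ 'n \<Rightarrow> real \<Rightarrow> bool" where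
  "has_dx i u x t \<longleftrightarrow> (\<lambda>s. u (x + s *\<^sub>R axis i 1) t) field_differentiable (at 0)"

(* C^{2,1}(Q), for Q open: u, u_t and all spatial partial derivatives of order at most two,
   mixed ones included, exist and are jointly continuous in (x, t) on Q. *)
definition C21_on :: "((real ^ 'n) \<times> real) set \<Rightarrow> (real ^ 'n \<Rightarrow> real \<Rightarrow> real) \<Rightarrow> bool" where
  "C21_on Q u \<longleftrightarrow>
     continuous_on Q (\<lambda>(x, t). u x t) \<and>
     (\<forall>(x, t)\<in>Q. has_dt u x t) \<and> continuous_on Q (\<lambda>(x, t). dt u x t) \<and>
     (\<forall>i. (\<forall>(x, t)\<in>Q. has_dx i u x t) \<and> continuous_on Q (\<lambda>(x, t). dx i u x t)) \<and>
     (\<forall>i j. (\<forall>(x, t)\<in>Q. has_dx j (dx i u) x t) \<and>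
            continuous_on Q (\<lambda>(x, t). dx j (dx i u) x t))"

definition classical_solution ::
    "real \<Rightarrow> real \<Rightarrow> real \<Rightarrow> ((real ^ 'n) \<times> real) set \<Rightarrow> (real ^ 'n \<Rightarrow> real \<Rightarrow> real) \<Rightarrow> bool" where
  "classical_solution p q M Q u \<longleftrightarrow>
     C21_on Q u \<and>
     (\<forall>(x, t)\<in>Q. dt u x t - laplacian u x t = u x t powr p + M * norm (grad u x t) powr q)"

definition M0 :: "nat \<Rightarrow> real \<Rightarrow> real" where
  "M0 N p = (6 * real N * (p + 1)) powr (p / (p + 1)) * sqrt ((p + 1) / (p - 1))"

end

theory Submission
  imports Defs
begin

text \<open>
  The proof is Bernstein's method for z = |grad u|^2. Since u_t \<le> 0, the equation gives
  -Laplace u \<ge> u^p + M z^(q/2), so the Hessian term of the Bochner identity is at least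
  (u^(2p) + M^2 z^q) / N; as q = 2p/(p+1), Young's inequality and M \<ge> M_0 let it absorb
  u^(p-1) z and still leave a multiple of z^q. The maximum principle is applied to
  \<rho>^k z + A (b - u)^2, where \<rho> is quadratic in x, linear in t and vanishes on the parabolic boundary.
  The choice A = 0 gives a bound independent of b, used for t > 1; a suitable A > 0 gives
  |grad u| \<le> C b (t^(-1/2) + 1/R), used for t \<le> 1, because (b - u)^2 contributes -2 A z
  with no bad term from the sources.

  Bernstein's method differentiates the equation, but u is only C^{2,1}. The maximum is therefore
  taken with grad u replaced by difference quotients of step h; the resulting inequality contains
  no third derivatives in the limit, and h \<rightarrow> 0 along a convergent subsequence of maximum points.
\<close>

subsection \<open>One-variable tests and inequalities\<close>

text \<open>Exponent: with A = 0 the inequality left at the maximum is \<rho> z^(q-1) \<le> C (1 +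
  T/r^2), so z scales like \<rho>^(-\<gamma>) with \<gamma> = 1/(q-1) = (p+1)/(p-1); hence the
  weight \<rho>^k with an integer k \<ge> \<gamma>. Auxiliary term: for A > 0 the critical-point
  condition reads grad(g z) = 2 A (b - u) grad u with g = \<rho>^k, and the new cross terms cost
  multiples of A^2 b^2 / g. Half of the gain 2 A z pays for them once g z \<ge> c A b^2; where this
  fails, g z is already bounded by A b^2, which is the desired estimate and the origin of the factor
  b. Two regimes: the time exponents 1/2 and \<gamma>/2 enclose the required (p+1)/(2p), so the less
  singular bound serves small t and the faster decaying one large t. Passage to the limit: the
  gradient term is handled as z^(q/2), whose derivative is singular at z = 0 because q < 2. A
  positive lower bound for g z at the limiting maximum keeps that point away from z = 0 and from the
  parabolic boundary at once.\<close>

lemma second_derivative_test: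
  fixes f f' :: "real \<Rightarrow> real"
  assumes "\<delta> > 0"
    and f: "\<And>s. \<bar>s\<bar> < \<delta> \<Longrightarrow> (f has_real_derivative f' s) (at s)"
    and f': "(f' has_real_derivative D) (at 0)"
    and max: "\<And>s. \<bar>s\<bar> < \<delta> \<Longrightarrow> f s \<le> f 0"
  shows "f' 0 = 0" and "D \<le> 0"
proof -
  show z: "f' 0 = 0"
    using DERIV_local_max[OF f[of 0] \<open>\<delta> > 0\<close>] max \<open>\<delta> > 0\<close> by auto
  show "D \<le> 0"
  proof (rule ccontr)
    assume "\<not> D \<le> 0"
    then obtain d where d: "d > 0" "\<And>h. 0 < h \<Longrightarrow> h < d \<Longrightarrow> f' 0 < f' (0 + h)"
      using DERIV_pos_inc_right[OF f'] by force
    define e where "e = min d \<delta> / 2"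
    have e: "0 < e" "e < d" "e < \<delta>" using d(1) \<open>\<delta> > 0\<close> by (auto simp: e_def min_def)
    obtain x where "0 < x" "x < e" "f e - f 0 = (e - 0) * f' x"
      using MVT2[of 0 e f f'] f e by force
    moreover have "f' x > 0" using d(2)[of x] z e calculation by auto
    ultimately have "f e - f 0 > 0" using e by simp
    then have "f e > f 0" by simp
    with max[of e] e show False by auto
  qed
qed

text \<open>\<open>V i\<close> is not tied to \<open>U\<close>: it will be a difference quotient of
  step h in direction i, while \<open>U\<close> is the solution itself. The test is the product rule
  along one line through the maximum.\<close>

lemma bernstein_second_derivative_test:
  fixes G G' U U' :: "real \<Rightarrow> real" and V V' :: "'i::finite \<Rightarrow> real \<Rightarrow> real"
  assumes "\<delta> > 0"
    and G: "\<And>s. \<bar>s\<bar> < \<delta> \<Longrightarrow> (G has_real_derivative G' s) (at s)"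
    and U: "\<And>s. \<bar>s\<bar> < \<delta> \<Longrightarrow> (U has_real_derivative U' s) (at s)"
    and V: "\<And>s i. \<bar>s\<bar> < \<delta> \<Longrightarrow> (V i has_real_derivative V' i s) (at s)"
    and G': "(G' has_real_derivative G2) (at 0)"
    and U': "(U' has_real_derivative U2) (at 0)"
    and V': "\<And>i. (V' i has_real_derivative V2 i) (at 0)"
    and max: "\<And>s. \<bar>s\<bar> < \<delta> \<Longrightarrow>
      G s * (\<Sum>i\<in>UNIV. (V i s)\<^sup>2) + A * (b - U s)\<^sup>2 \<le> G 0 * (\<Sum>i\<in>UNIV. (V i 0)\<^sup>2) + A * (b - U 0)\<^sup>2"
  shows "G' 0 * (\<Sum>i\<in>UNIV. (V i 0)\<^sup>2) + 2 * G 0 * (\<Sum>i\<in>UNIV. V i 0 * V' i 0) - 2 * A * (b - U 0) * U' 0 = 0"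
    and "G2 * (\<Sum>i\<in>UNIV. (V i 0)\<^sup>2) + 4 * G' 0 * (\<Sum>i\<in>UNIV. V i 0 * V' i 0)
       + 2 * G 0 * (\<Sum>i\<in>UNIV. (V' i 0)\<^sup>2) + 2 * G 0 * (\<Sum>i\<in>UNIV. V i 0 * V2 i)
       + 2 * A * (U' 0)\<^sup>2 - 2 * A * (b - U 0) * U2 \<le> 0"
proof -
  define f where "f s = G s * (\<Sum>i\<in>UNIV. (V i s)\<^sup>2) + A * (b - U s)\<^sup>2" for s
  define f' where "f' s = G' s * (\<Sum>i\<in>UNIV. (V i s)\<^sup>2) + 2 * G s * (\<Sum>i\<in>UNIV. V i s * V' i s)
    - 2 * A * (b - U s) * U' s" for s
  have 1: "(f has_real_derivative f' s) (at s)" if "\<bar>s\<bar> < \<delta>" for s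
    unfolding f_def f'_def
    by (rule derivative_eq_intros G[OF that] U[OF that] V[OF that] refl)+
       (simp add: algebra_simps sum_distrib_left)
  have d0: "\<bar>0\<bar> < \<delta>" using \<open>\<delta> > 0\<close> by simp
  have 2: "(f' has_real_derivative (G2 * (\<Sum>i\<in>UNIV. (V i 0)\<^sup>2) + 4 * G' 0 * (\<Sum>i\<in>UNIV. V i 0 * V' i 0)
       + 2 * G 0 * (\<Sum>i\<in>UNIV. (V' i 0)\<^sup>2) + 2 * G 0 * (\<Sum>i\<in>UNIV. V i 0 * V2 i)
       + 2 * A * (U' 0)\<^sup>2 - 2 * A * (b - U 0) * U2)) (at 0)"
    unfolding f'_def
    by (rule derivative_eq_intros G[OF d0] U[OF d0] V[OF d0] G' U' V' refl)+
       (simp add: algebra_simps sum_distrib_left power2_eq_square sum.distrib)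
  note t = second_derivative_test[OF \<open>\<delta> > 0\<close> 1 2]
  from t(1) max show "G' 0 * (\<Sum>i\<in>UNIV. (V i 0)\<^sup>2) + 2 * G 0 * (\<Sum>i\<in>UNIV. V i 0 * V' i 0)
      - 2 * A * (b - U 0) * U' 0 = 0"
    by (simp add: f_def f'_def)
  from t(2) max show "G2 * (\<Sum>i\<in>UNIV. (V i 0)\<^sup>2) + 4 * G' 0 * (\<Sum>i\<in>UNIV. V i 0 * V' i 0)
       + 2 * G 0 * (\<Sum>i\<in>UNIV. (V' i 0)\<^sup>2) + 2 * G 0 * (\<Sum>i\<in>UNIV. V i 0 * V2 i)
       + 2 * A * (U' 0)\<^sup>2 - 2 * A * (b - U 0) * U2 \<le> 0"
    by (simp add: f_def)
qed

text \<open>Only earlier times are compared, because a maximum over a closed time interval may sit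
  at its final time.\<close>

lemma derivative_nonneg_at_left_max:
  fixes f :: "real \<Rightarrow> real"
  assumes "(f has_real_derivative D) (at t)" "\<delta> > 0"
    and "\<And>s. t - \<delta> < s \<Longrightarrow> s \<le> t \<Longrightarrow> f s \<le> f t"
  shows "D \<ge> 0"
proof (rule ccontr)
  assume "\<not> D \<ge> 0"
  then obtain d where d: "d > 0" "\<And>h. 0 < h \<Longrightarrow> h < d \<Longrightarrow> f t < f (t - h)"
    using DERIV_neg_dec_left[OF assms(1)] by force
  define e where "e = min d \<delta> / 2"
  have e: "0 < e" "e < d" "e < \<delta>" using d(1) \<open>\<delta> > 0\<close> by (auto simp: e_def min_def)
  with d(2)[of e] assms(3)[of "t - e"] show False by auto
qed

lemma bernstein_time_test:
  fixes G U :: "real \<Rightarrow> real" and V :: "'i::finite \<Rightarrow> real \<Rightarrow> real"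
  assumes "\<delta> > 0"
    and G: "(G has_real_derivative G') (at t)"
    and U: "(U has_real_derivative U') (at t)"
    and V: "\<And>i. (V i has_real_derivative V' i) (at t)"
    and max: "\<And>s. t - \<delta> < s \<Longrightarrow> s \<le> t \<Longrightarrow>
      G s * (\<Sum>i\<in>UNIV. (V i s)\<^sup>2) + A * (b - U s)\<^sup>2 \<le> G t * (\<Sum>i\<in>UNIV. (V i t)\<^sup>2) + A * (b - U t)\<^sup>2"
  shows "0 \<le> G' * (\<Sum>i\<in>UNIV. (V i t)\<^sup>2) + 2 * G t * (\<Sum>i\<in>UNIV. V i t * V' i) - 2 * A * (b - U t) * U'"
proof -
  have "((\<lambda>s. G s * (\<Sum>i\<in>UNIV. (V i s)\<^sup>2) + A * (b - U s)\<^sup>2) has_real_derivative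
     (G' * (\<Sum>i\<in>UNIV. (V i t)\<^sup>2) + 2 * G t * (\<Sum>i\<in>UNIV. V i t * V' i) - 2 * A * (b - U t) * U')) (at t)"
    by (rule derivative_eq_intros G U V refl)+
       (simp add: algebra_simps sum_distrib_left)
  from derivative_nonneg_at_left_max[OF this \<open>\<delta> > 0\<close> max] show ?thesis by simp
qed

section \<open>Real powers and the absorption of the reaction term\<close>

lemma powr_diff_mvt:
  fixes a b p :: real
  assumes "a \<ge> 0" "b \<ge> 0" "p > 0"
  obtains c where "min a b \<le> c" "c \<le> max a b" "a powr p - b powr p = p * c powr (p - 1) * (a - b)"
proof -
  have *: "\<exists>c. x \<le> c \<and> c \<le> y \<and> y powr p - x powr p = p * c powr (p - 1) * (y - x)"
    if "0 \<le> x" "x < y" for x y :: real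
  proof -
    have d: "((\<lambda>s. s powr p) has_real_derivative p * s powr (p - 1)) (at s)" if "x < s" for s
      using that \<open>0 \<le> x\<close> by (auto intro!: derivative_eq_intros)
    have "continuous_on {x..y} (\<lambda>s. s powr p)"
      using that \<open>p > 0\<close> by (intro continuous_on_powr') auto
    then obtain l c where c: "x < c" "c < y" "((\<lambda>s. s powr p) has_real_derivative l) (at c)"
      "y powr p - x powr p = (y - x) * l"
      using MVT[OF \<open>x < y\<close>, of "\<lambda>s. s powr p"] d by (metis real_differentiable_def)
    with DERIV_unique[OF c(3) d[OF c(1)]] show ?thesis
      by (intro exI[of _ c]) auto
  qed
  consider "a = b" | "a < b" | "b < a" by linarith
  then show ?thesis
  proof cases
    case 1 then show ?thesis using that[of a] by auto
  next
    case 2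
    from *[OF assms(1) 2] obtain c where "a \<le> c" "c \<le> b" "b powr p - a powr p = p * c powr (p - 1) * (b - a)" by auto
    then show ?thesis using that[of c] 2 by (auto simp: algebra_simps)
  next
    case 3
    from *[OF assms(2) 3] show ?thesis using that 3 by auto
  qed
qed

text \<open>As (p+1)(q-1) = p-1, comparing u^(p+1) with N p z decides which term wins: if u^(p+1) is
  larger, N p u^(p-1) z \<le> u^(2p); otherwise u^(p-1) z \<le> (N p)^(q-1) z^q, and M \<ge> M_0
  takes over. The Hessian will supply 2/N times both squares; only half of the second is spent here,
  and the other half yields the estimate.\<close>

lemma reaction_absorption:
  fixes p q M u z :: real
  assumes p: "p > 1" and q: "q = 2 * p / (p + 1)" and M: "M \<ge> M0 N p" and N: "N \<ge> 1"
    and u: "u \<ge> 0" and z: "z > 0"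
  shows "2 * p * u powr (p - 1) * z \<le> 2 / N * (u powr p)\<^sup>2 + M\<^sup>2 / N * z powr q"
proof -
  have q1: "q - 1 = (p - 1) / (p + 1)" using p q by (simp add: field_simps)
  have Nr: "real N \<ge> 1" using N by simp
  show ?thesis
  proof (cases "u powr (p + 1) \<ge> N * p * z")
    case True
    have "N * (p * u powr (p - 1) * z) = u powr (p - 1) * (N * p * z)" by simp
    also have "\<dots> \<le> u powr (p - 1) * u powr (p + 1)" using True by (intro mult_left_mono) auto
    also have "\<dots> = (u powr p)\<^sup>2" by (simp add: powr_add[symmetric] power2_eq_square)
    finally have "2 * p * u powr (p - 1) * z \<le> 2 / N * (u powr p)\<^sup>2"
      using Nr by (simp add: field_simps)
    moreover have "0 \<le> M\<^sup>2 / N * z powr q" by simp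
    ultimately show ?thesis by linarith
  next
    case False
    have "u powr (p - 1) = (u powr (p + 1)) powr (q - 1)" using p by (simp add: powr_powr q1)
    also have "\<dots> \<le> (N * p * z) powr (q - 1)" using False p by (intro powr_mono2) (auto simp: q1)
    also have "\<dots> = (N * p) powr (q - 1) * z powr (q - 1)" using p z by (simp add: powr_mult)
    finally have "u powr (p - 1) * z \<le> (N * p) powr (q - 1) * z powr (q - 1) * z" using z by simp
    also have "\<dots> = (N * p) powr (q - 1) * z powr q"
      using z by (simp add: powr_diff)
    finally have 1: "u powr (p - 1) * z \<le> (N * p) powr (q - 1) * z powr q" .
    \<comment> \<open>The square of \<open>M0\<close> is (6N(p+1))^q (p+1)/(p-1). Writing the power
      as base times base^(q-1), the two factors dominate 2pN and (Np)^(q-1), and the last quotient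
      exceeds 1.\<close>
    have "p * N \<le> (6 * (p + 1)) * N" "(2 * p) * N \<le> (6 * (p + 1)) * N"
      using p by (intro mult_right_mono; simp)+
    then have "N * p \<le> 6 * N * (p + 1)" "2 * p * N \<le> 6 * N * (p + 1)" by (simp_all add: mult_ac)
    then have "2 * p * N * (N * p) powr (q - 1) \<le> 6 * N * (p + 1) * (6 * N * (p + 1)) powr (q - 1)"
      using p by (rule_tac mult_mono) (auto simp: q1 intro!: powr_mono2)
    also have "\<dots> = (6 * N * (p + 1)) powr q"
      using p Nr by (simp add: powr_diff)
    also have "\<dots> \<le> (6 * N * (p + 1)) powr q * ((p + 1) / (p - 1))"
      using p by (simp add: field_simps mult_left_mono)
    also have "\<dots> = (M0 N p)\<^sup>2"
      using p by (simp add: M0_def power_mult_distrib power2_eq_square[of "_ powr _"] powr_add[symmetric] q)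
    also have "\<dots> \<le> M\<^sup>2" using M p by (intro power_mono) (auto simp: M0_def)
    finally have 2: "2 * p * (N * p) powr (q - 1) \<le> M\<^sup>2 / N" using Nr by (simp add: field_simps)
    have "2 * p * u powr (p - 1) * z \<le> 2 * p * ((N * p) powr (q - 1) * z powr q)"
      using 1 p by simp
    also have "\<dots> \<le> M\<^sup>2 / N * z powr q" using mult_right_mono[OF 2, of "z powr q"] by (simp add: mult_ac)
    finally show ?thesis by (smt (verit) divide_nonneg_nonneg mult_nonneg_nonneg of_nat_0_le_iff zero_le_power2)
  qed
qed

subsection \<open>The algebraic inequality at a maximum point\<close>

lemma young_weighted:
  fixes a c e :: real
  assumes "e > 0"
  shows "2 * a * c \<le> e * a\<^sup>2 + c\<^sup>2 / e"
proof -
  have "0 \<le> (e * a - c)\<^sup>2 / e" using assms by simp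
  also have "\<dots> = e * a\<^sup>2 + c\<^sup>2 / e - 2 * a * c"
    using assms by (simp add: field_simps power2_eq_square)
  finally show ?thesis by simp
qed

lemma square_trace_le:
  fixes H :: "'n::finite \<Rightarrow> 'n \<Rightarrow> real"
  shows "(\<Sum>i\<in>UNIV. H i i)\<^sup>2 \<le> real CARD('n) * (\<Sum>j\<in>UNIV. \<Sum>i\<in>UNIV. (H i j)\<^sup>2)"
proof -
  have "(\<Sum>i\<in>UNIV. 1 * H i i)\<^sup>2 \<le> (\<Sum>i\<in>(UNIV::'n set). (1::real)\<^sup>2) * (\<Sum>i\<in>(UNIV::'n set). (H i i)\<^sup>2)"
    by (rule Cauchy_Schwarz_ineq_sum)
  also have "\<dots> = real CARD('n) * (\<Sum>i\<in>UNIV. (H i i)\<^sup>2)" by simp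
  also have "\<dots> \<le> real CARD('n) * (\<Sum>j\<in>UNIV. \<Sum>i\<in>UNIV. (H i j)\<^sup>2)"
  proof (intro mult_left_mono sum_mono)
    show "(H j j)\<^sup>2 \<le> (\<Sum>i\<in>UNIV. (H i j)\<^sup>2)" for j
      using member_le_sum[of j UNIV "\<lambda>i. (H i j)\<^sup>2"] by simp
  qed simp
  finally show ?thesis by simp
qed

text \<open>Dictionary: \<open>PG\<close> = grad g . grad u, \<open>S\<close> = |grad g|^2,
  \<open>HH\<close> = |Hess u|^2, \<open>PHP\<close> and \<open>GHP\<close> = the Hessian applied to
  grad u and paired with grad u and grad g, \<open>\<beta>\<close> = A (b - u), \<open>X\<close> =
  u^p, \<open>Y\<close> = z^(q/2), \<open>w\<close> = z^(q/2-1), \<open>k\<close> = p u^(p-1) z. The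
  contracted critical-point conditions \<open>e1\<close> and \<open>e2\<close> replace
  \<open>PHP\<close> and \<open>GHP\<close> by first-order quantities, so no part of the Hessian
  term is spent on them. After \<open>k\<close> is absorbed, -(g/N)(M Y)^2 remains: one quarter pays
  for the product of \<open>M Y\<close> with \<open>PG\<close>, one for that with
  \<open>\<beta>\<close>, and half survives.\<close>

lemma bernstein_scalar:
  fixes A b g q M N S X Y z \<beta> PG GHP PHP HH w L k :: real
  assumes g: "g > 0" and z: "z > 0" and N: "N > 0" and q: "1 \<le> q" "q \<le> 2" and M: "M \<ge> 0"
    and X: "X \<ge> 0" and Y: "Y = w * z" "Y \<ge> 0" and \<beta>: "0 \<le> \<beta>" "\<beta> \<le> A * b" and A: "A \<ge> 0"
    and e1: "z * PG + 2 * g * PHP = 2 * \<beta> * z"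
    and e2: "z * S + 2 * g * GHP = 2 * \<beta> * PG"
    and cs: "PG\<^sup>2 \<le> S * z"
    and hh: "(X + M * Y)\<^sup>2 \<le> N * HH"
    and k: "2 * k \<le> 2 / N * X\<^sup>2 + M\<^sup>2 / N * Y\<^sup>2"
    and main: "0 \<le> L * z - 4 * GHP - 2 * g * HH + 2 * g * k + 2 * g * M * q * w * PHP
       - 2 * \<beta> * (X + M * Y) - 2 * A * z"
    and big: "(2 + 4 * N) * A * b\<^sup>2 \<le> g * z"
  shows "A * z + M\<^sup>2 / (2 * N) * g * Y\<^sup>2 \<le> z * (L + (4 + 4 * N) * S / g)"
proof -
  have GHP: "- 4 * GHP = (2 * z * S - 4 * \<beta> * PG) / g"
    using e2 g by (simp add: field_simps)
  have "- (4 * \<beta> * PG) \<le> 2 * \<beta>\<^sup>2 + 2 * PG\<^sup>2"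
    using zero_le_power2[of "\<beta> + PG"] by (simp add: power2_eq_square algebra_simps)
  then have 1: "- 4 * GHP \<le> (4 * S * z + 2 * \<beta>\<^sup>2) / g"
    unfolding GHP using g cs by (intro divide_right_mono) auto
  have "2 * g * PHP = z * (2 * \<beta> - PG)" using e1 by (simp add: algebra_simps)
  then have "2 * g * M * q * w * PHP = M * q * w * (z * (2 * \<beta> - PG))" by (metis mult.assoc mult.commute)
  then have PHP: "2 * g * M * q * w * PHP = 2 * (M * Y) * q * \<beta> + 2 * (M * Y) * (- q / 2 * PG)"
    by (simp add: Y(1) algebra_simps)
  \<comment> \<open>With this weight each use of Young's inequality costs exactly one quarter of
    (g/N)(M Y)^2.\<close>
  have e: "g / (4 * N) > 0" using g N by simp
  have "(q / 2)\<^sup>2 \<le> 1" using q by (simp add: power_le_one)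
  then have "(q / 2)\<^sup>2 * PG\<^sup>2 \<le> 1 * (S * z)" using cs by (intro mult_mono) auto
  then have "(- q / 2 * PG)\<^sup>2 \<le> S * z" by (simp add: power_mult_distrib power_divide)
  then have "(- q / 2 * PG)\<^sup>2 / (g / (4 * N)) \<le> S * z / (g / (4 * N))"
    using e by (intro divide_right_mono) auto
  then have 2: "2 * (M * Y) * (- q / 2 * PG) \<le> g / (4 * N) * (M * Y)\<^sup>2 + 4 * N * S * z / g"
    using young_weighted[OF e, of "M * Y" "- q / 2 * PG"] by (simp add: mult_ac)
  \<comment> \<open>The subtracted term is the gradient source entering through (b - u)^2; it lowers
    the coefficient q to q - 1 \<le> 1.\<close>
  have "2 * (M * Y) * q * \<beta> - 2 * (M * Y) * \<beta> = 2 * (M * Y) * ((q - 1) * \<beta>)" by (simp add: algebra_simps)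
  also have "\<dots> \<le> 2 * (M * Y) * \<beta>"
    using q M Y \<beta> by (intro mult_left_mono mult_left_le_one_le) auto
  also have "\<dots> \<le> g / (4 * N) * (M * Y)\<^sup>2 + 4 * N * \<beta>\<^sup>2 / g"
    using young_weighted[OF e, of "M * Y" \<beta>] by (simp add: mult_ac)
  finally have 3: "2 * (M * Y) * q * \<beta> - 2 * (M * Y) * \<beta> \<le> g / (4 * N) * (M * Y)\<^sup>2 + 4 * N * \<beta>\<^sup>2 / g" .
  have "X\<^sup>2 + (M * Y)\<^sup>2 \<le> (X + M * Y)\<^sup>2"
    using X M Y(2) by (simp add: power2_sum)
  with hh have "(X\<^sup>2 + (M * Y)\<^sup>2) / N \<le> HH" using N by (simp add: field_simps)
  then have "k - HH \<le> - (M * Y)\<^sup>2 / (2 * N)"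
    using k N by (simp add: field_simps power_mult_distrib)
  then have "2 * g * (k - HH) \<le> 2 * g * (- (M * Y)\<^sup>2 / (2 * N))" using g by (intro mult_left_mono) auto
  then have 4: "2 * g * k - 2 * g * HH \<le> - g / N * (M * Y)\<^sup>2" by (simp add: algebra_simps)
  \<comment> \<open>The multiples of \<beta>^2 / g collected so far are 2 (from \<open>GHP\<close>)
    and 4N (from Young). \<open>big\<close> turns their sum into A z, half of the available 2 A
    z.\<close>
  have "\<beta>\<^sup>2 \<le> (A * b)\<^sup>2" using \<beta> by (intro power_mono) auto
  then have "(2 + 4 * N) * \<beta>\<^sup>2 \<le> (2 + 4 * N) * (A * b)\<^sup>2" using N by (intro mult_left_mono) auto
  also have "\<dots> = A * ((2 + 4 * N) * A * b\<^sup>2)" by (simp add: power2_eq_square algebra_simps)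
  also have "\<dots> \<le> A * (g * z)" using A big by (intro mult_left_mono) auto
  finally have 5: "(2 + 4 * N) * \<beta>\<^sup>2 / g \<le> A * z" using g by (simp add: field_simps)
  have X0: "0 \<le> \<beta> * X" using \<beta> X by simp
  have a: "(2 + 4 * N) * \<beta>\<^sup>2 / g = 2 * \<beta>\<^sup>2 / g + 4 * N * \<beta>\<^sup>2 / g" "(4 * S * z + 2 * \<beta>\<^sup>2) / g = 4 * S * z / g + 2 * \<beta>\<^sup>2 / g"
    "z * (L + (4 + 4 * N) * S / g) = L * z + 4 * S * z / g + 4 * N * S * z / g"
    "M\<^sup>2 / (2 * N) * g * Y\<^sup>2 = g / N * (M * Y)\<^sup>2 - g / (4 * N) * (M * Y)\<^sup>2 - g / (4 * N) * (M * Y)\<^sup>2"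
    "- g / N * (M * Y)\<^sup>2 = - (g / N * (M * Y)\<^sup>2)" "2 * \<beta> * (X + M * Y) = 2 * (\<beta> * X) + 2 * (M * Y) * \<beta>"
    by (simp_all add: add_divide_distrib algebra_simps power_mult_distrib)
  show ?thesis
    using main 1 2 3 4 5 X0 unfolding PHP a by linarith
qed

text \<open>Here P i, H i j and G j stand for the derivatives u_i, u_ij and g_j of the solution and of the weight
  g = \<rho>^k at the maximum point, L for the heat operator applied to g, and z for |grad u|^2.\<close>
lemma bernstein_algebra:
  fixes P G :: "'n::finite \<Rightarrow> real" and H :: "'n \<Rightarrow> 'n \<Rightarrow> real" and p q M A b u z g L :: real
  assumes p: "p > 1" and q: "q = 2 * p / (p + 1)" and M: "M \<ge> M0 CARD('n) p"
    and A: "A \<ge> 0" and u: "0 \<le> u" "u \<le> b" and z: "z = (\<Sum>i\<in>UNIV. (P i)\<^sup>2)" "z > 0" and g: "g > 0"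
    and first: "\<And>j. G j * z + 2 * g * (\<Sum>i\<in>UNIV. P i * H i j) - 2 * A * (b - u) * P j = 0"
    and trace: "u powr p + M * z powr (q / 2) \<le> - (\<Sum>i\<in>UNIV. H i i)"
    and second: "0 \<le> L * z - 4 * (\<Sum>j\<in>UNIV. G j * (\<Sum>i\<in>UNIV. P i * H i j))
      - 2 * g * (\<Sum>j\<in>UNIV. \<Sum>i\<in>UNIV. (H i j)\<^sup>2)
      + 2 * g * (\<Sum>i\<in>UNIV. P i * (p * u powr (p - 1) * P i
          + M * (q / 2 * z powr (q / 2 - 1) * (\<Sum>j\<in>UNIV. 2 * P j * H i j))))
      - 2 * A * (b - u) * (u powr p + M * z powr (q / 2)) - 2 * A * z"
    and big: "(2 + 4 * real CARD('n)) * A * b\<^sup>2 \<le> g * z"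
  shows "A + M\<^sup>2 / (2 * real CARD('n)) * g * z powr (q - 1)
      \<le> L + (4 + 4 * real CARD('n)) * (\<Sum>j\<in>UNIV. (G j)\<^sup>2) / g"
proof -
  let ?N = "real CARD('n)"
  define PG where "PG = (\<Sum>j\<in>UNIV. G j * P j)"
  define GHP where "GHP = (\<Sum>j\<in>UNIV. G j * (\<Sum>i\<in>UNIV. P i * H i j))"
  define PHP where "PHP = (\<Sum>j\<in>UNIV. P j * (\<Sum>i\<in>UNIV. P i * H i j))"
  have M0: "M \<ge> 0" using M p by (smt (verit) M0_def mult_nonneg_nonneg powr_ge_zero real_sqrt_ge_zero divide_nonneg_nonneg)
  have q12: "1 \<le> q" "q \<le> 2" unfolding q using p by (auto simp: field_simps)
  have fj: "G j * z + 2 * g * (\<Sum>i\<in>UNIV. P i * H i j) = 2 * (A * (b - u)) * P j" for j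
    using first[of j] by simp
  \<comment> \<open>Pairs the vector equation \<open>first\<close> with an arbitrary vector
    \<open>c\<close>; it is used for grad u and for grad g.\<close>
  have contract: "z * (\<Sum>j\<in>UNIV. G j * c j) + 2 * g * (\<Sum>j\<in>UNIV. c j * S j) = \<gamma> * (\<Sum>j\<in>UNIV. c j * P j)"
    if "\<And>j. G j * z + 2 * g * S j = \<gamma> * P j" for c S \<gamma>
  proof -
    have "(\<Sum>j\<in>UNIV. c j * (G j * z + 2 * g * S j)) = (\<Sum>j\<in>UNIV. c j * (\<gamma> * P j))" by (simp add: that)
    then show ?thesis by (simp add: distrib_left sum.distrib sum_distrib_left mult_ac)
  qed
  have e1: "z * PG + 2 * g * PHP = 2 * (A * (b - u)) * z"
    using contract[OF fj, of P] by (simp add: PG_def PHP_def z(1) power2_eq_square)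
  have e2: "z * (\<Sum>j\<in>UNIV. (G j)\<^sup>2) + 2 * g * GHP = 2 * (A * (b - u)) * PG"
    using contract[OF fj, of G] by (simp add: PG_def GHP_def power2_eq_square)
  have cs: "PG\<^sup>2 \<le> (\<Sum>j\<in>UNIV. (G j)\<^sup>2) * z"
    unfolding PG_def z(1) by (rule Cauchy_Schwarz_ineq_sum)
  have "(u powr p + M * z powr (q / 2))\<^sup>2 \<le> (- (\<Sum>i\<in>UNIV. H i i))\<^sup>2"
    using trace M0 by (intro power_mono) auto
  with square_trace_le[of H] have hh: "(u powr p + M * z powr (q / 2))\<^sup>2 \<le> ?N * (\<Sum>j\<in>UNIV. \<Sum>i\<in>UNIV. (H i j)\<^sup>2)"
    by simp
  have Y2: "(z powr (q / 2))\<^sup>2 = z powr q" by (simp add: power2_eq_square powr_add[symmetric])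
  have k: "2 * (p * u powr (p - 1) * z) \<le> 2 / ?N * (u powr p)\<^sup>2 + M\<^sup>2 / ?N * (z powr (q / 2))\<^sup>2"
    using reaction_absorption[OF p q M _ u(1) z(2)] unfolding Y2 by (simp add: Suc_le_eq)
  have Y: "z powr (q / 2) = z powr (q / 2 - 1) * z" using z by (simp add: powr_diff)
  have "(\<Sum>i\<in>UNIV. P i * (p * u powr (p - 1) * P i
          + M * (q / 2 * z powr (q / 2 - 1) * (\<Sum>j\<in>UNIV. 2 * P j * H i j))))
      = p * u powr (p - 1) * (\<Sum>i\<in>UNIV. (P i)\<^sup>2) + M * q * z powr (q / 2 - 1) * (\<Sum>i\<in>UNIV. \<Sum>j\<in>UNIV. P i * (P j * H i j))"
    by (simp add: sum.distrib sum_distrib_left sum_divide_distrib algebra_simps power2_eq_square)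
  also have "(\<Sum>i\<in>UNIV. \<Sum>j\<in>UNIV. P i * (P j * H i j)) = PHP"
    unfolding PHP_def by (subst sum.swap) (simp add: sum_distrib_left algebra_simps)
  finally have f: "(\<Sum>i\<in>UNIV. P i * (p * u powr (p - 1) * P i
          + M * (q / 2 * z powr (q / 2 - 1) * (\<Sum>j\<in>UNIV. 2 * P j * H i j))))
      = p * u powr (p - 1) * z + M * q * z powr (q / 2 - 1) * PHP" unfolding z(1) .
  have main: "0 \<le> L * z - 4 * GHP - 2 * g * (\<Sum>j\<in>UNIV. \<Sum>i\<in>UNIV. (H i j)\<^sup>2)
       + 2 * g * (p * u powr (p - 1) * z) + 2 * g * M * q * z powr (q / 2 - 1) * PHP
       - 2 * (A * (b - u)) * (u powr p + M * z powr (q / 2)) - 2 * A * z"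
    using second unfolding f GHP_def[symmetric] by (simp add: algebra_simps)
  have "A * z + M\<^sup>2 / (2 * ?N) * g * (z powr (q / 2))\<^sup>2 \<le> z * (L + (4 + 4 * ?N) * (\<Sum>j\<in>UNIV. (G j)\<^sup>2) / g)"
    by (rule bernstein_scalar[OF g z(2) _ q12 M0 _ Y _ _ _ A e1 e2 cs hh k main big])
       (use A u in \<open>auto intro: mult_left_mono\<close>)
  moreover have "(z powr (q / 2))\<^sup>2 = z * z powr (q - 1)" unfolding Y2 using z by (simp add: powr_diff)
  ultimately have "z * (A + M\<^sup>2 / (2 * ?N) * g * z powr (q - 1)) \<le> z * (L + (4 + 4 * ?N) * (\<Sum>j\<in>UNIV. (G j)\<^sup>2) / g)"
    by (simp add: algebra_simps)
  with z(2) show ?thesis by (simp only: mult_le_cancel_left_pos)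
qed

subsection \<open>Difference quotients\<close>

lemma has_dx_along:
  assumes "has_dx i w (x + s *\<^sub>R axis i 1) t"
  shows "((\<lambda>r. w (x + r *\<^sub>R axis i 1) t) has_real_derivative dx i w (x + s *\<^sub>R axis i 1) t) (at s)"
proof -
  have "((\<lambda>r. w (x + s *\<^sub>R axis i 1 + r *\<^sub>R axis i 1) t) has_real_derivative dx i w (x + s *\<^sub>R axis i 1) t) (at 0)"
    using assms unfolding has_dx_def dx_def by (simp add: DERIV_deriv_iff_field_differentiable)
  then have "((\<lambda>r. w (x + (r + s) *\<^sub>R axis i 1) t) has_real_derivative dx i w (x + s *\<^sub>R axis i 1) t) (at 0)"
    by (simp add: scaleR_left_distrib add_ac)
  then show ?thesis using DERIV_shift[of "\<lambda>r. w (x + r *\<^sub>R axis i 1) t" _ 0 s] by simp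
qed

lemma has_dt_deriv: "has_dt w x t \<Longrightarrow> (w x has_real_derivative dt w x t) (at t)"
  unfolding has_dt_def dt_def by (simp add: DERIV_deriv_iff_field_differentiable)

lemma tendsto_within_open:
  fixes F :: "real ^ 'n \<Rightarrow> real \<Rightarrow> real"
  assumes "open Q" "(x, t) \<in> Q" "continuous_on Q (\<lambda>(x, t). F x t)" "xs \<longlonglongrightarrow> x" "ts \<longlonglongrightarrow> t"
  shows "(\<lambda>n. F (xs n) (ts n)) \<longlonglongrightarrow> F x t"
proof -
  have "isCont (\<lambda>(x, t). F x t) (x, t)"
    using assms(1-3) by (simp add: continuous_on_eq_continuous_at)
  from isCont_tendsto_compose[OF this tendsto_Pair[OF assms(4,5)]] show ?thesis by simp
qed

text \<open>Base point and step vary together, so differentiability at the limit alone would not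
  suffice: the mean value theorem gives \<open>dx i w\<close> at an intermediate point, and joint
  continuity of \<open>dx i w\<close> gives the limit.\<close>

lemma difference_quotient_tendsto:
  fixes w :: "real ^ 'n::finite \<Rightarrow> real \<Rightarrow> real"
  assumes Q: "open Q" "(x, t) \<in> Q"
    and d: "\<And>y s. (y, s) \<in> Q \<Longrightarrow> has_dx i w y s" and c: "continuous_on Q (\<lambda>(x, t). dx i w x t)"
    and xs: "xs \<longlonglongrightarrow> x" and ts: "ts \<longlonglongrightarrow> t" and hs: "hs \<longlonglongrightarrow> 0" "\<And>n. hs n > 0"
  shows "(\<lambda>n. (w (xs n + hs n *\<^sub>R axis i 1) (ts n) - w (xs n) (ts n)) / hs n) \<longlonglongrightarrow> dx i w x t"
proof -
  define dq where "dq n = (w (xs n + hs n *\<^sub>R axis i 1) (ts n) - w (xs n) (ts n)) / hs n" for n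
  \<comment> \<open>The segment carrying the quotient lies in Q only for large n; for the other n
    the intermediate parameter is a placeholder 0.\<close>
  define C where "C n \<longleftrightarrow> (\<forall>s\<in>{0..hs n}. (xs n + s *\<^sub>R axis i 1, ts n) \<in> Q)" for n
  have "\<exists>\<theta>. 0 \<le> \<theta> \<and> \<theta> \<le> hs n \<and> (C n \<longrightarrow> dq n = dx i w (xs n + \<theta> *\<^sub>R axis i 1) (ts n))" for n
  proof (cases "C n")
    case True
    then have "((\<lambda>r. w (xs n + r *\<^sub>R axis i 1) (ts n)) has_real_derivative dx i w (xs n + s *\<^sub>R axis i 1) (ts n)) (at s)"
      if "0 \<le> s" "s \<le> hs n" for s
      using that by (intro has_dx_along d) (auto simp: C_def)
    from MVT2[OF hs(2) this] obtain \<theta> where "0 < \<theta>" "\<theta> < hs n"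
      "w (xs n + hs n *\<^sub>R axis i 1) (ts n) - w (xs n + 0 *\<^sub>R axis i 1) (ts n) = (hs n - 0) * dx i w (xs n + \<theta> *\<^sub>R axis i 1) (ts n)"
      by blast
    then show ?thesis using hs(2)[of n] by (intro exI[of _ \<theta>]) (auto simp: dq_def field_simps)
  next
    case False
    then show ?thesis using hs(2)[of n] by (intro exI[of _ 0]) auto
  qed
  then obtain \<theta> where th: "\<And>n. 0 \<le> \<theta> n" "\<And>n. \<theta> n \<le> hs n"
    "\<And>n. C n \<Longrightarrow> dq n = dx i w (xs n + \<theta> n *\<^sub>R axis i 1) (ts n)" by metis
  have th0: "\<theta> \<longlonglongrightarrow> 0"
    by (rule tendsto_sandwich[OF _ _ tendsto_const hs(1)]) (use th in auto)
  have "(\<lambda>n. xs n + \<theta> n *\<^sub>R axis i 1) \<longlonglongrightarrow> x + 0 *\<^sub>R axis i 1"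
    by (intro tendsto_intros xs th0)
  then have lim: "(\<lambda>n. dx i w (xs n + \<theta> n *\<^sub>R axis i 1) (ts n)) \<longlonglongrightarrow> dx i w x t"
    by (intro tendsto_within_open[OF Q c _ ts]) simp
  obtain A B where AB: "open A" "open B" "x \<in> A" "t \<in> B" "A \<times> B \<subseteq> Q"
    using Q open_prod_elim[of Q "(x, t)"] by (metis mem_Sigma_iff)
  then obtain e where e: "e > 0" "ball x e \<subseteq> A" by (meson open_contains_ball)
  have "\<forall>\<^sub>F n in sequentially. dist (xs n) x < e / 2" using tendstoD[OF xs, of "e / 2"] e by simp
  moreover have "\<forall>\<^sub>F n in sequentially. ts n \<in> B" using ts AB by (auto simp: topological_tendstoD)
  moreover have "\<forall>\<^sub>F n in sequentially. hs n < e / 2" using order_tendstoD(2)[OF hs(1), of "e / 2"] e by simp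
  ultimately have "\<forall>\<^sub>F n in sequentially. C n"
  proof eventually_elim
    case (elim n)
    have "dist x (xs n + s *\<^sub>R axis i 1) < e" if "0 \<le> s" "s \<le> hs n" for s
    proof -
      have "dist x (xs n + s *\<^sub>R axis i 1) \<le> dist x (xs n) + dist (xs n) (xs n + s *\<^sub>R axis i 1)" by (rule dist_triangle)
      also have "dist (xs n) (xs n + s *\<^sub>R axis i 1) = s" using that by (simp add: dist_norm)
      finally show ?thesis using elim that by (simp add: dist_commute)
    qed
    then have "(xs n + s *\<^sub>R axis i 1, ts n) \<in> A \<times> B" if "0 \<le> s" "s \<le> hs n" for s
      using that e(2) elim(2) by (auto simp: subset_iff)
    from subsetD[OF AB(5) this] show ?case unfolding C_def by simp
  qed
  then have "\<forall>\<^sub>F n in sequentially. dx i w (xs n + \<theta> n *\<^sub>R axis i 1) (ts n) = dq n"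
    by eventually_elim (use th in auto)
  from Lim_transform_eventually[OF lim this] show ?thesis unfolding dq_def .
qed

text \<open>The factor x^(p-1) at the intermediate value must converge, which is what the condition
  on \<open>l\<close> secures. It will be used with exponent p > 1 for u, which may vanish, and with
  exponent q/2 < 1 for |grad u|^2 at a point where the gradient is nonzero.\<close>

lemma powr_difference_quotient_tendsto:
  fixes a c h :: "nat \<Rightarrow> real"
  assumes p: "p > 0" and nn: "\<And>n. a n \<ge> 0" "\<And>n. c n \<ge> 0"
    and lim: "a \<longlonglongrightarrow> l" "c \<longlonglongrightarrow> l" "(\<lambda>n. (a n - c n) / h n) \<longlonglongrightarrow> d"
    and l: "l > 0 \<or> p > 1"
  shows "(\<lambda>n. (a n powr p - c n powr p) / h n) \<longlonglongrightarrow> p * l powr (p - 1) * d"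
proof -
  have "\<exists>x. min (a n) (c n) \<le> x \<and> x \<le> max (a n) (c n) \<and> a n powr p - c n powr p = p * x powr (p - 1) * (a n - c n)" for n
    using powr_diff_mvt[OF nn(1) nn(2) p] by metis
  then obtain x where x: "\<And>n. min (a n) (c n) \<le> x n" "\<And>n. x n \<le> max (a n) (c n)"
    "\<And>n. a n powr p - c n powr p = p * x n powr (p - 1) * (a n - c n)" by metis
  have "x \<longlonglongrightarrow> l"
  proof (rule tendsto_sandwich)
    show "(\<lambda>n. min (a n) (c n)) \<longlonglongrightarrow> l" "(\<lambda>n. max (a n) (c n)) \<longlonglongrightarrow> l"
      using tendsto_min[OF lim(1,2)] tendsto_max[OF lim(1,2)] by simp_all
  qed (use x in auto)
  moreover have "0 \<le> x n" for n using x(1)[of n] nn[of n] by linarith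
  ultimately have "(\<lambda>n. x n powr (p - 1)) \<longlonglongrightarrow> l powr (p - 1)"
    using l by (intro tendsto_powr') auto
  then have "(\<lambda>n. p * x n powr (p - 1) * ((a n - c n) / h n)) \<longlonglongrightarrow> p * l powr (p - 1) * d"
    by (intro tendsto_mult tendsto_const lim)
  then show ?thesis by (simp add: x(3) mult_ac)
qed

subsection \<open>The cut-off function\<close>

text \<open>Squaring the spatial factor makes |grad \<rho>|^2 = 16 (t - \<tau>) \<rho> |x - c|^2 /
  r^4 a bounded multiple of \<rho>, so that |grad \<rho>^k|^2 / \<rho>^k is of order \<rho>^(k-1),
  like the other terms produced by the weight.\<close>

definition cutoff :: "real ^ 'n \<Rightarrow> real \<Rightarrow> real \<Rightarrow> real ^ 'n \<Rightarrow> real \<Rightarrow> real" where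
  "cutoff c r \<tau> x t = (t - \<tau>) * (1 - (norm (x - c))\<^sup>2 / r\<^sup>2)\<^sup>2"

definition cutoff_dx :: "real ^ 'n \<Rightarrow> real \<Rightarrow> real \<Rightarrow> 'n \<Rightarrow> real ^ 'n \<Rightarrow> real \<Rightarrow> real" where
  "cutoff_dx c r \<tau> j x t = - 4 * (t - \<tau>) * (1 - (norm (x - c))\<^sup>2 / r\<^sup>2) * (x - c) $ j / r\<^sup>2"

definition cutoff_dxx :: "real ^ 'n \<Rightarrow> real \<Rightarrow> real \<Rightarrow> 'n \<Rightarrow> real ^ 'n \<Rightarrow> real \<Rightarrow> real" where
  "cutoff_dxx c r \<tau> j x t = (t - \<tau>) * (8 * ((x - c) $ j)\<^sup>2 / r ^ 4 - 4 * (1 - (norm (x - c))\<^sup>2 / r\<^sup>2) / r\<^sup>2)"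

lemma norm_along_axis:
  fixes x c :: "real ^ 'n::finite"
  shows "(norm (x + s *\<^sub>R axis j 1 - c))\<^sup>2 = (norm (x - c))\<^sup>2 + 2 * s * (x - c) $ j + s\<^sup>2"
proof -
  have "x + s *\<^sub>R axis j 1 - c = (x - c) + s *\<^sub>R axis j 1" by simp
  then have "(norm (x + s *\<^sub>R axis j 1 - c))\<^sup>2 = ((x - c) + s *\<^sub>R axis j 1) \<bullet> ((x - c) + s *\<^sub>R axis j 1)"
    by (simp only: dot_square_norm)
  also have "\<dots> = (x - c) \<bullet> (x - c) + 2 * s * ((x - c) \<bullet> axis j 1) + s\<^sup>2 * (axis j 1 \<bullet> (axis j 1 :: real ^ 'n))"
    by (simp add: inner_add_left inner_add_right inner_commute power2_eq_square algebra_simps)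
  finally show ?thesis by (simp add: dot_square_norm inner_axis inner_axis_axis)
qed

lemma cutoff_deriv:
  fixes x c :: "real ^ 'n::finite"
  assumes "r > 0"
  shows "((\<lambda>s. cutoff c r \<tau> (x + s *\<^sub>R axis j 1) t) has_real_derivative cutoff_dx c r \<tau> j (x + s *\<^sub>R axis j 1) t) (at s)"
    and "((\<lambda>s. cutoff_dx c r \<tau> j (x + s *\<^sub>R axis j 1) t) has_real_derivative cutoff_dxx c r \<tau> j (x + s *\<^sub>R axis j 1) t) (at s)"
    and "((\<lambda>s. cutoff c r \<tau> x s) has_real_derivative (1 - (norm (x - c))\<^sup>2 / r\<^sup>2)\<^sup>2) (at t)"
proof -
  let ?y = "(x - c) $ j" and ?n = "(norm (x - c))\<^sup>2"
  have comp: "(x + s *\<^sub>R axis j 1 - c) $ j = ?y + s" for s by (simp add: axis_def)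
  have r4: "r ^ 4 = (r\<^sup>2)\<^sup>2" by (simp flip: power_mult)
  have 1: "((\<lambda>s. a * (1 - (n + 2 * s * y + s\<^sup>2) / R)\<^sup>2) has_real_derivative
      - 4 * a * (1 - (n + 2 * s * y + s\<^sup>2) / R) * (y + s) / R) (at s)"
    and 2: "((\<lambda>s. - 4 * a * (1 - (n + 2 * s * y + s\<^sup>2) / R) * (y + s) / R) has_real_derivative
      a * (8 * (y + s)\<^sup>2 / R\<^sup>2 - 4 * (1 - (n + 2 * s * y + s\<^sup>2) / R) / R)) (at s)"
    if "R > 0" for a n y R :: real
  proof -
    define f where "f s = 1 - (n + 2 * s * y + s\<^sup>2) / R" for s
    have f: "(f has_real_derivative - 2 * (y + s) / R) (at s)"
      unfolding f_def using that by (auto intro!: derivative_eq_intros simp: field_simps)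
    have "((\<lambda>s. a * (f s)\<^sup>2) has_real_derivative - 4 * a * f s * (y + s) / R) (at s)"
      by (rule derivative_eq_intros f refl)+ (simp add: algebra_simps)
    then show "((\<lambda>s. a * (1 - (n + 2 * s * y + s\<^sup>2) / R)\<^sup>2) has_real_derivative
      - 4 * a * (1 - (n + 2 * s * y + s\<^sup>2) / R) * (y + s) / R) (at s)" unfolding f_def .
    have "((\<lambda>s. - 4 * a * f s * (y + s) / R) has_real_derivative a * (8 * (y + s)\<^sup>2 / R\<^sup>2 - 4 * f s / R)) (at s)"
      by (rule derivative_eq_intros f refl)+
        (use that in \<open>simp_all add: field_simps power2_eq_square\<close>)
    then show "((\<lambda>s. - 4 * a * (1 - (n + 2 * s * y + s\<^sup>2) / R) * (y + s) / R) has_real_derivative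
      a * (8 * (y + s)\<^sup>2 / R\<^sup>2 - 4 * (1 - (n + 2 * s * y + s\<^sup>2) / R) / R)) (at s)" unfolding f_def .
  qed
  have R: "r\<^sup>2 > 0" using assms by simp
  show "((\<lambda>s. cutoff c r \<tau> (x + s *\<^sub>R axis j 1) t) has_real_derivative cutoff_dx c r \<tau> j (x + s *\<^sub>R axis j 1) t) (at s)"
    unfolding cutoff_def cutoff_dx_def norm_along_axis comp by (rule 1[OF R])
  show "((\<lambda>s. cutoff_dx c r \<tau> j (x + s *\<^sub>R axis j 1) t) has_real_derivative cutoff_dxx c r \<tau> j (x + s *\<^sub>R axis j 1) t) (at s)"
    unfolding cutoff_dx_def cutoff_dxx_def norm_along_axis comp r4 by (rule 2[OF R])
  show "((\<lambda>s. cutoff c r \<tau> x s) has_real_derivative (1 - ?n / r\<^sup>2)\<^sup>2) (at t)"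
    unfolding cutoff_def by (auto intro!: derivative_eq_intros)
qed

text \<open>Truncated subtraction in the exponents is harmless: whenever k - 1 or k - 2 is cut off,
  a factor \<open>k\<close> or \<open>real (k - 1)\<close> vanishes.\<close>

lemma cutoff_power_deriv:
  fixes x c :: "real ^ 'n::finite"
  assumes "r > 0"
  shows "((\<lambda>s. cutoff c r \<tau> (x + s *\<^sub>R axis j 1) t ^ k) has_real_derivative
      k * cutoff c r \<tau> (x + s *\<^sub>R axis j 1) t ^ (k - 1) * cutoff_dx c r \<tau> j (x + s *\<^sub>R axis j 1) t) (at s)"
    and "((\<lambda>s. k * cutoff c r \<tau> (x + s *\<^sub>R axis j 1) t ^ (k - 1) * cutoff_dx c r \<tau> j (x + s *\<^sub>R axis j 1) t) has_real_derivative
      k * (real (k - 1) * cutoff c r \<tau> x t ^ (k - 2) * (cutoff_dx c r \<tau> j x t)\<^sup>2 + cutoff c r \<tau> x t ^ (k - 1) * cutoff_dxx c r \<tau> j x t)) (at 0)"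
    and "((\<lambda>s. cutoff c r \<tau> x s ^ k) has_real_derivative
      k * cutoff c r \<tau> x t ^ (k - 1) * (1 - (norm (x - c))\<^sup>2 / r\<^sup>2)\<^sup>2) (at t)"
proof -
  show "((\<lambda>s. cutoff c r \<tau> (x + s *\<^sub>R axis j 1) t ^ k) has_real_derivative
      k * cutoff c r \<tau> (x + s *\<^sub>R axis j 1) t ^ (k - 1) * cutoff_dx c r \<tau> j (x + s *\<^sub>R axis j 1) t) (at s)"
    by (rule DERIV_cong[OF DERIV_power[OF cutoff_deriv(1)[OF assms]]]) (simp only: One_nat_def mult_ac)
  have "((\<lambda>s. k * (cutoff c r \<tau> (x + s *\<^sub>R axis j 1) t ^ (k - 1) * cutoff_dx c r \<tau> j (x + s *\<^sub>R axis j 1) t)) has_real_derivative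
      k * (real (k - 1) * cutoff c r \<tau> x t ^ (k - 2) * (cutoff_dx c r \<tau> j x t)\<^sup>2 + cutoff c r \<tau> x t ^ (k - 1) * cutoff_dxx c r \<tau> j x t)) (at 0)"
  proof (rule DERIV_cmult)
    define f f' where "f s = cutoff c r \<tau> (x + s *\<^sub>R axis j 1) t" and "f' s = cutoff_dx c r \<tau> j (x + s *\<^sub>R axis j 1) t" for s
    have f: "(f has_real_derivative f' 0) (at 0)" and f': "(f' has_real_derivative cutoff_dxx c r \<tau> j (x + 0 *\<^sub>R axis j 1) t) (at 0)"
      unfolding f_def f'_def by (intro cutoff_deriv assms)+
    have "((\<lambda>s. f s ^ (k - 1) * f' s) has_real_derivative
        real (k - 1) * f 0 ^ (k - 2) * (f' 0)\<^sup>2 + f 0 ^ (k - 1) * cutoff_dxx c r \<tau> j (x + 0 *\<^sub>R axis j 1) t) (at 0)"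
      by (rule derivative_eq_intros f f' refl)+ (simp add: power2_eq_square numeral_2_eq_2)
    then show "((\<lambda>s. cutoff c r \<tau> (x + s *\<^sub>R axis j 1) t ^ (k - 1) * cutoff_dx c r \<tau> j (x + s *\<^sub>R axis j 1) t) has_real_derivative
      real (k - 1) * cutoff c r \<tau> x t ^ (k - 2) * (cutoff_dx c r \<tau> j x t)\<^sup>2 + cutoff c r \<tau> x t ^ (k - 1) * cutoff_dxx c r \<tau> j x t) (at 0)"
      by (simp only: f_def f'_def scaleR_zero_left add_0_right)
  qed
  then show "((\<lambda>s. k * cutoff c r \<tau> (x + s *\<^sub>R axis j 1) t ^ (k - 1) * cutoff_dx c r \<tau> j (x + s *\<^sub>R axis j 1) t) has_real_derivative
      k * (real (k - 1) * cutoff c r \<tau> x t ^ (k - 2) * (cutoff_dx c r \<tau> j x t)\<^sup>2 + cutoff c r \<tau> x t ^ (k - 1) * cutoff_dxx c r \<tau> j x t)) (at 0)"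
    by (simp only: mult.assoc)
  show "((\<lambda>s. cutoff c r \<tau> x s ^ k) has_real_derivative
      k * cutoff c r \<tau> x t ^ (k - 1) * (1 - (norm (x - c))\<^sup>2 / r\<^sup>2)\<^sup>2) (at t)"
    by (rule DERIV_cong[OF DERIV_power[OF cutoff_deriv(3)[OF assms]]]) (simp only: One_nat_def mult_ac)
qed

text \<open>The left side is the heat operator applied to g = \<rho>^k plus (4 + 4N) |grad g|^2 / g,
  the right side of \<open>bernstein_algebra\<close>. The time derivative contributes k, the
  Laplacian of \<rho> contributes 4Nk, the quotient contributes 16 (4 + 4N) k^2, and the term with
  k(k-1) |grad \<rho>|^2 has a favourable sign. A common factor \<rho>^(k-1) comes out.\<close>

lemma cutoff_heat_bound:
  fixes x c :: "real ^ 'n::finite"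
  assumes r: "r > 0" and x: "norm (x - c) < r" and t: "\<tau> < t" "t \<le> \<tau> + T" and k: "k \<ge> 2"
  defines "\<rho> \<equiv> cutoff c r \<tau> x t" and "N \<equiv> real CARD('n)"
  shows "k * \<rho> ^ (k - 1) * (1 - (norm (x - c))\<^sup>2 / r\<^sup>2)\<^sup>2
     - (\<Sum>j\<in>UNIV. k * (real (k - 1) * \<rho> ^ (k - 2) * (cutoff_dx c r \<tau> j x t)\<^sup>2 + \<rho> ^ (k - 1) * cutoff_dxx c r \<tau> j x t))
     + (4 + 4 * N) * (\<Sum>j\<in>UNIV. (k * \<rho> ^ (k - 1) * cutoff_dx c r \<tau> j x t)\<^sup>2) / \<rho> ^ k
     \<le> (k + 4 * N * k + 64 * (1 + N) * (real k)\<^sup>2) * \<rho> ^ (k - 1) * (1 + T / r\<^sup>2)"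
proof -
  define \<zeta> where "\<zeta> = 1 - (norm (x - c))\<^sup>2 / r\<^sup>2"
  define a where "a = t - \<tau>"
  have a: "0 < a" "a \<le> T" using t by (auto simp: a_def)
  have nr: "(norm (x - c))\<^sup>2 < r\<^sup>2" using x r by (simp add: power_strict_mono)
  then have z: "0 < \<zeta>" "\<zeta> \<le> 1" using r by (auto simp: \<zeta>_def)
  have \<rho>_eq: "\<rho> = a * \<zeta>\<^sup>2" by (simp add: \<rho>_def cutoff_def \<zeta>_def a_def)
  then have \<rho>: "\<rho> > 0" using a z by simp
  have N: "N \<ge> 0" by (simp add: N_def)
  have n2: "(\<Sum>j\<in>UNIV. ((x - c) $ j)\<^sup>2) = (norm (x - c))\<^sup>2"
    by (simp add: norm_vec_def L2_set_def sum_nonneg)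
  have "(cutoff_dx c r \<tau> j x t)\<^sup>2 = 16 * a * \<rho> / r ^ 4 * ((x - c) $ j)\<^sup>2" for j
  proof -
    have "(- 4 * a * \<zeta> * y / r\<^sup>2)\<^sup>2 = 16 * a * (a * \<zeta>\<^sup>2) / r ^ 4 * y\<^sup>2" for y :: real
      using r by (simp add: field_simps power2_eq_square power4_eq_xxxx)
    then show ?thesis unfolding cutoff_dx_def \<zeta>_def[symmetric] a_def[symmetric] \<rho>_eq .
  qed
  then have S: "(\<Sum>j\<in>UNIV. (cutoff_dx c r \<tau> j x t)\<^sup>2) = 16 * a * \<rho> / r ^ 4 * (norm (x - c))\<^sup>2"
    by (simp only: sum_distrib_left[symmetric] n2)
  have "a * \<rho> * (norm (x - c))\<^sup>2 \<le> T * \<rho> * r\<^sup>2"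
    using a \<rho> nr by (intro mult_mono) auto
  then have "16 * (a * \<rho> * (norm (x - c))\<^sup>2) / r ^ 4 \<le> 16 * (T * \<rho> * r\<^sup>2) / r ^ 4"
    by (intro divide_right_mono) auto
  also have "\<dots> = 16 * \<rho> * (T / r\<^sup>2)"
    using r by (simp add: field_simps power2_eq_square power4_eq_xxxx)
  finally have S': "(\<Sum>j\<in>UNIV. (cutoff_dx c r \<tau> j x t)\<^sup>2) \<le> 16 * \<rho> * (T / r\<^sup>2)"
    unfolding S by (simp add: mult_ac)
  have S0: "(\<Sum>j\<in>UNIV. (cutoff_dx c r \<tau> j x t)\<^sup>2) \<ge> 0" by (simp add: sum_nonneg)
  have "- cutoff_dxx c r \<tau> j x t \<le> 4 * (T / r\<^sup>2)" for j
  proof -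
    have "- cutoff_dxx c r \<tau> j x t = 4 * (a * \<zeta>) / r\<^sup>2 - a * (8 * ((x - c) $ j)\<^sup>2 / r ^ 4)"
      unfolding cutoff_dxx_def \<zeta>_def[symmetric] a_def[symmetric] right_diff_distrib by simp
    also have "\<dots> \<le> 4 * (a * \<zeta>) / r\<^sup>2" using a by simp
    also have "\<dots> \<le> 4 * (T * 1) / r\<^sup>2" using a z by (intro divide_right_mono mult_left_mono mult_mono) auto
    finally show ?thesis by simp
  qed
  then have "(\<Sum>j\<in>UNIV. - cutoff_dxx c r \<tau> j x t) \<le> (\<Sum>j\<in>(UNIV::'n set). 4 * (T / r\<^sup>2))" by (intro sum_mono)
  then have D: "- (\<Sum>j\<in>UNIV. cutoff_dxx c r \<tau> j x t) \<le> 4 * N * (T / r\<^sup>2)"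
    by (simp add: sum_negf N_def mult_ac)
  have "k * \<rho> ^ (k - 1) * \<zeta>\<^sup>2 \<le> k * \<rho> ^ (k - 1) * 1"
    using \<rho> z by (intro mult_left_mono) (auto simp: power_le_one)
  moreover have "(\<Sum>j\<in>UNIV. k * (real (k - 1) * \<rho> ^ (k - 2) * (cutoff_dx c r \<tau> j x t)\<^sup>2 + \<rho> ^ (k - 1) * cutoff_dxx c r \<tau> j x t))
     = k * real (k - 1) * \<rho> ^ (k - 2) * (\<Sum>j\<in>UNIV. (cutoff_dx c r \<tau> j x t)\<^sup>2)
       - k * \<rho> ^ (k - 1) * (- (\<Sum>j\<in>UNIV. cutoff_dxx c r \<tau> j x t))"
    by (simp add: sum.distrib sum_distrib_left distrib_left mult_ac)
  moreover have "0 \<le> k * real (k - 1) * \<rho> ^ (k - 2) * (\<Sum>j\<in>UNIV. (cutoff_dx c r \<tau> j x t)\<^sup>2)"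
    using S0 \<rho> by simp
  moreover have "k * \<rho> ^ (k - 1) * (- (\<Sum>j\<in>UNIV. cutoff_dxx c r \<tau> j x t)) \<le> k * \<rho> ^ (k - 1) * (4 * N * (T / r\<^sup>2))"
    using \<rho> by (intro mult_left_mono D) auto
  moreover have "(4 + 4 * N) * (\<Sum>j\<in>UNIV. (k * \<rho> ^ (k - 1) * cutoff_dx c r \<tau> j x t)\<^sup>2) / \<rho> ^ k
      \<le> 64 * (1 + N) * (real k)\<^sup>2 * \<rho> ^ (k - 1) * (T / r\<^sup>2)"
  proof -
    obtain m where m: "k = m + 2" using k by (metis add.commute le_Suc_ex)
    have "(4 + 4 * N) * (\<Sum>j\<in>UNIV. (k * \<rho> ^ (k - 1) * cutoff_dx c r \<tau> j x t)\<^sup>2) / \<rho> ^ k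
       = (4 + 4 * N) * (real k)\<^sup>2 * \<rho> ^ m * (\<Sum>j\<in>UNIV. (cutoff_dx c r \<tau> j x t)\<^sup>2)"
    proof -
      have "(\<rho> ^ (k - 1))\<^sup>2 = \<rho> ^ m * \<rho> ^ k"
        by (simp add: m power2_eq_square mult_ac flip: power_add)
      then have "(\<Sum>j\<in>UNIV. (k * \<rho> ^ (k - 1) * cutoff_dx c r \<tau> j x t)\<^sup>2)
         = \<rho> ^ k * ((real k)\<^sup>2 * \<rho> ^ m * (\<Sum>j\<in>UNIV. (cutoff_dx c r \<tau> j x t)\<^sup>2))"
        by (simp add: power_mult_distrib mult_ac flip: sum_distrib_left)
      then show ?thesis using \<rho> by simp
    qed
    also have "\<dots> \<le> (4 + 4 * N) * (real k)\<^sup>2 * \<rho> ^ m * (16 * \<rho> * (T / r\<^sup>2))"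
      using \<rho> N by (intro mult_left_mono S') auto
    also have "\<dots> = 64 * (1 + N) * (real k)\<^sup>2 * \<rho> ^ (k - 1) * (T / r\<^sup>2)"
      by (simp add: m algebra_simps)
    finally show ?thesis .
  qed
  moreover have "0 \<le> k * \<rho> ^ (k - 1) * (T / r\<^sup>2)" "0 \<le> (4 * N * k + 64 * (1 + N) * (real k)\<^sup>2) * \<rho> ^ (k - 1)"
    using \<rho> N a by auto
  moreover have "(k + 4 * N * k + 64 * (1 + N) * (real k)\<^sup>2) * \<rho> ^ (k - 1) * (1 + T / r\<^sup>2)
     = k * \<rho> ^ (k - 1) * 1 + k * \<rho> ^ (k - 1) * (T / r\<^sup>2) + k * \<rho> ^ (k - 1) * (4 * N * (T / r\<^sup>2))
       + 64 * (1 + N) * (real k)\<^sup>2 * \<rho> ^ (k - 1) * (T / r\<^sup>2) + (4 * N * k + 64 * (1 + N) * (real k)\<^sup>2) * \<rho> ^ (k - 1)"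
    by (simp add: algebra_simps)
  ultimately show ?thesis unfolding \<zeta>_def[symmetric] by linarith
qed

subsection \<open>The maximum principle for difference quotients\<close>

definition fd :: "real \<Rightarrow> 'n \<Rightarrow> (real ^ 'n \<Rightarrow> real \<Rightarrow> real) \<Rightarrow> real ^ 'n \<Rightarrow> real \<Rightarrow> real" where
  "fd h i w x t = (w (x + h *\<^sub>R axis i 1) t - w x t) / h"

text \<open>Translations commute, so differentiating a difference quotient means differencing the
  derivative. Hence \<open>fd h i u\<close> is as smooth as u and can be differentiated twice, which
  grad u cannot.\<close>

lemma fd_along:
  assumes "has_dx j w (x + s *\<^sub>R axis j 1) t" "has_dx j w (x + s *\<^sub>R axis j 1 + h *\<^sub>R axis i 1) t"
  shows "((\<lambda>s. fd h i w (x + s *\<^sub>R axis j 1) t) has_real_derivative fd h i (dx j w) (x + s *\<^sub>R axis j 1) t) (at s)"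
proof -
  have eq: "x + s *\<^sub>R axis j 1 + h *\<^sub>R axis i 1 = (x + h *\<^sub>R axis i 1) + s *\<^sub>R axis j 1" for s
    by (simp add: add_ac)
  show ?thesis
    unfolding fd_def eq
    by (intro DERIV_cdivide DERIV_diff has_dx_along assms(1) assms(2)[unfolded eq])
qed

definition source :: "real \<Rightarrow> real \<Rightarrow> real \<Rightarrow> (real ^ 'n \<Rightarrow> real \<Rightarrow> real) \<Rightarrow> real ^ 'n \<Rightarrow> real \<Rightarrow> real" where
  "source p q M u x t = u x t powr p + M * norm (grad u x t) powr q"

text \<open>Only the gradient is discretised: (b - u)^2 already has the one time and two space
  derivatives that the maximum principle uses.\<close>

definition bernstein :: "(real ^ 'n \<Rightarrow> real \<Rightarrow> real) \<Rightarrow> real \<Rightarrow> real \<Rightarrow> (real ^ 'n \<Rightarrow> real \<Rightarrow> real) \<Rightarrow> real \<Rightarrow>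
    real ^ 'n \<Rightarrow> real \<Rightarrow> real" where
  "bernstein g A b u h x t = g x t * (\<Sum>i\<in>UNIV. (fd h i u x t)\<^sup>2) + A * (b - u x t)\<^sup>2"

text \<open>The second-derivative tests in all coordinate directions are added and combined with the
  time test. The terms that would become third derivatives as h tends to 0 occur only as the heat
  operator applied to \<open>fd h i u\<close>, and this equals the differenced source.\<close>

lemma finite_difference_inequality:
  fixes u :: "real ^ 'n::finite \<Rightarrow> real \<Rightarrow> real"
  assumes Q: "open Q" and sol: "classical_solution p q M Q u"
    and xt: "(x, t) \<in> Q" and shift: "\<And>i. (x + h *\<^sub>R axis i 1, t) \<in> Q"
    and g1: "\<And>j s. ((\<lambda>s. g (x + s *\<^sub>R axis j 1) t) has_real_derivative gd j (x + s *\<^sub>R axis j 1) t) (at s)"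
    and g2: "\<And>j. ((\<lambda>s. gd j (x + s *\<^sub>R axis j 1) t) has_real_derivative gdd j x t) (at 0)"
    and g3: "((\<lambda>s. g x s) has_real_derivative gt x t) (at t)"
    and \<delta>: "\<delta> > 0"
    and max: "\<And>y s. dist y x < \<delta> \<Longrightarrow> t - \<delta> < s \<Longrightarrow> s \<le> t \<Longrightarrow> bernstein g A b u h y s \<le> bernstein g A b u h x t"
  shows "gd j x t * (\<Sum>i\<in>UNIV. (fd h i u x t)\<^sup>2) + 2 * g x t * (\<Sum>i\<in>UNIV. fd h i u x t * fd h i (dx j u) x t)
      - 2 * A * (b - u x t) * dx j u x t = 0"
    and "0 \<le> (gt x t - (\<Sum>j\<in>UNIV. gdd j x t)) * (\<Sum>i\<in>UNIV. (fd h i u x t)\<^sup>2)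
      - 4 * (\<Sum>j\<in>UNIV. gd j x t * (\<Sum>i\<in>UNIV. fd h i u x t * fd h i (dx j u) x t))
      - 2 * g x t * (\<Sum>j\<in>UNIV. \<Sum>i\<in>UNIV. (fd h i (dx j u) x t)\<^sup>2)
      + 2 * g x t * (\<Sum>i\<in>UNIV. fd h i u x t * fd h i (source p q M u) x t)
      - 2 * A * (b - u x t) * source p q M u x t - 2 * A * (\<Sum>j\<in>UNIV. (dx j u x t)\<^sup>2)"
proof -
  have dt: "has_dt u y s" and d1: "has_dx i u y s" and d2: "has_dx i (dx j u) y s"
    and eq: "dt u y s - laplacian u y s = source p q M u y s"
    if "(y, s) \<in> Q" for y s i j
    using sol that unfolding classical_solution_def C21_on_def source_def by blast+
  \<comment> \<open>Near x along axis j, both the point and all its shifts by h stay in the open set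
    Q, so the one-variable tests apply.\<close>
  have near: "\<exists>d>0. \<forall>s. \<bar>s\<bar> < d \<longrightarrow> dist (x + s *\<^sub>R axis j 1) x < \<delta> \<and> (x + s *\<^sub>R axis j 1, t) \<in> Q \<and>
      (\<forall>i. (x + s *\<^sub>R axis j 1 + h *\<^sub>R axis i 1, t) \<in> Q)" for j
  proof -
    have *: "\<forall>\<^sub>F s in nhds 0. (x + s *\<^sub>R axis j 1 + y, t) \<in> Q" if "(x + y, t) \<in> Q" for y
    proof -
      have "((\<lambda>s. (x + s *\<^sub>R axis j 1 + y, t)) \<longlongrightarrow> (x + 0 *\<^sub>R axis j 1 + y, t)) (nhds 0)"
        by (intro tendsto_intros filterlim_ident)
      from topological_tendstoD[OF this Q] that show ?thesis by simp
    qed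
    have "\<forall>\<^sub>F s in nhds 0. (\<forall>i. (x + s *\<^sub>R axis j 1 + h *\<^sub>R axis i 1, t) \<in> Q)"
      using * shift by (intro eventually_all_finite) auto
    moreover have "\<forall>\<^sub>F s in nhds 0. (x + s *\<^sub>R axis j 1, t) \<in> Q" using *[of 0] xt by simp
    ultimately have "\<forall>\<^sub>F s in nhds 0. (x + s *\<^sub>R axis j 1, t) \<in> Q \<and> (\<forall>i. (x + s *\<^sub>R axis j 1 + h *\<^sub>R axis i 1, t) \<in> Q)"
      by eventually_elim simp
    then obtain d where "d > 0" "\<And>s. \<bar>s\<bar> < d \<Longrightarrow> (x + s *\<^sub>R axis j 1, t) \<in> Q \<and> (\<forall>i. (x + s *\<^sub>R axis j 1 + h *\<^sub>R axis i 1, t) \<in> Q)"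
      by (auto simp: eventually_nhds_metric)
    then show ?thesis using \<delta> by (intro exI[of _ "min d \<delta>"]) (auto simp: dist_norm)
  qed
  have space: "gd j x t * (\<Sum>i\<in>UNIV. (fd h i u x t)\<^sup>2) + 2 * g x t * (\<Sum>i\<in>UNIV. fd h i u x t * fd h i (dx j u) x t)
      - 2 * A * (b - u x t) * dx j u x t = 0 \<and>
      gdd j x t * (\<Sum>i\<in>UNIV. (fd h i u x t)\<^sup>2) + 4 * gd j x t * (\<Sum>i\<in>UNIV. fd h i u x t * fd h i (dx j u) x t)
       + 2 * g x t * (\<Sum>i\<in>UNIV. (fd h i (dx j u) x t)\<^sup>2) + 2 * g x t * (\<Sum>i\<in>UNIV. fd h i u x t * fd h i (dx j (dx j u)) x t)
       + 2 * A * (dx j u x t)\<^sup>2 - 2 * A * (b - u x t) * dx j (dx j u) x t \<le> 0" for j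
  proof -
    obtain d where d: "d > 0" "\<And>s. \<bar>s\<bar> < d \<Longrightarrow> dist (x + s *\<^sub>R axis j 1) x < \<delta>"
      "\<And>s. \<bar>s\<bar> < d \<Longrightarrow> (x + s *\<^sub>R axis j 1, t) \<in> Q"
      "\<And>s i. \<bar>s\<bar> < d \<Longrightarrow> (x + s *\<^sub>R axis j 1 + h *\<^sub>R axis i 1, t) \<in> Q" using near[of j] by metis
    have 0: "\<bar>0\<bar> < d" using d by simp
    have U: "((\<lambda>s. u (x + s *\<^sub>R axis j 1) t) has_real_derivative dx j u (x + s *\<^sub>R axis j 1) t) (at s)"
      and V: "((\<lambda>s. fd h i u (x + s *\<^sub>R axis j 1) t) has_real_derivative fd h i (dx j u) (x + s *\<^sub>R axis j 1) t) (at s)"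
      if "\<bar>s\<bar> < d" for s i
      using d(3,4)[OF that] by (auto intro!: has_dx_along fd_along d1)
    have U': "((\<lambda>s. dx j u (x + s *\<^sub>R axis j 1) t) has_real_derivative dx j (dx j u) (x + 0 *\<^sub>R axis j 1) t) (at 0)"
      and V': "((\<lambda>s. fd h i (dx j u) (x + s *\<^sub>R axis j 1) t) has_real_derivative fd h i (dx j (dx j u)) (x + 0 *\<^sub>R axis j 1) t) (at 0)" for i
      using d(3,4)[OF 0] by (auto intro!: has_dx_along fd_along d2 simp del: scaleR_zero_left)
    have m: "g (x + s *\<^sub>R axis j 1) t * (\<Sum>i\<in>UNIV. (fd h i u (x + s *\<^sub>R axis j 1) t)\<^sup>2) + A * (b - u (x + s *\<^sub>R axis j 1) t)\<^sup>2
       \<le> g (x + 0 *\<^sub>R axis j 1) t * (\<Sum>i\<in>UNIV. (fd h i u (x + 0 *\<^sub>R axis j 1) t)\<^sup>2) + A * (b - u (x + 0 *\<^sub>R axis j 1) t)\<^sup>2"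
      if "\<bar>s\<bar> < d" for s
      using max[OF d(2)[OF that], of t] \<delta> by (simp add: bernstein_def)
    show ?thesis
      using bernstein_second_derivative_test[OF d(1) g1 U V g2 U' V' m] by simp
  qed
  then show "gd j x t * (\<Sum>i\<in>UNIV. (fd h i u x t)\<^sup>2) + 2 * g x t * (\<Sum>i\<in>UNIV. fd h i u x t * fd h i (dx j u) x t)
      - 2 * A * (b - u x t) * dx j u x t = 0" by blast
  have "(fd h i u x has_real_derivative fd h i (dt u) x t) (at t)" for i
    unfolding fd_def using shift xt by (intro DERIV_cdivide DERIV_diff has_dt_deriv dt) auto
  then have time: "0 \<le> gt x t * (\<Sum>i\<in>UNIV. (fd h i u x t)\<^sup>2) + 2 * g x t * (\<Sum>i\<in>UNIV. fd h i u x t * fd h i (dt u) x t)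
      - 2 * A * (b - u x t) * dt u x t"
    using max \<delta> by (intro bernstein_time_test[OF \<delta> g3 has_dt_deriv[OF dt[OF xt]]]) (auto simp: bernstein_def)
  have "(\<Sum>j\<in>UNIV. gdd j x t * (\<Sum>i\<in>UNIV. (fd h i u x t)\<^sup>2) + 4 * gd j x t * (\<Sum>i\<in>UNIV. fd h i u x t * fd h i (dx j u) x t)
       + 2 * g x t * (\<Sum>i\<in>UNIV. (fd h i (dx j u) x t)\<^sup>2) + 2 * g x t * (\<Sum>i\<in>UNIV. fd h i u x t * fd h i (dx j (dx j u)) x t)
       + 2 * A * (dx j u x t)\<^sup>2 - 2 * A * (b - u x t) * dx j (dx j u) x t) \<le> 0"
    using space by (intro sum_nonpos) auto
  then have sp: "(\<Sum>j\<in>UNIV. gdd j x t) * (\<Sum>i\<in>UNIV. (fd h i u x t)\<^sup>2)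
      + 4 * (\<Sum>j\<in>UNIV. gd j x t * (\<Sum>i\<in>UNIV. fd h i u x t * fd h i (dx j u) x t))
      + 2 * g x t * (\<Sum>j\<in>UNIV. \<Sum>i\<in>UNIV. (fd h i (dx j u) x t)\<^sup>2)
      + 2 * g x t * (\<Sum>j\<in>UNIV. \<Sum>i\<in>UNIV. fd h i u x t * fd h i (dx j (dx j u)) x t)
      + 2 * A * (\<Sum>j\<in>UNIV. (dx j u x t)\<^sup>2) - 2 * A * (b - u x t) * laplacian u x t \<le> 0"
    by (simp add: sum.distrib sum_subtractf laplacian_def mult.assoc flip: sum_distrib_left sum_distrib_right)
  \<comment> \<open>The equation at x is subtracted from the equation at the shifted point.\<close>
  have "(\<Sum>i\<in>UNIV. fd h i u x t * fd h i (dt u) x t) - (\<Sum>j\<in>UNIV. \<Sum>i\<in>UNIV. fd h i u x t * fd h i (dx j (dx j u)) x t)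
      = (\<Sum>i\<in>UNIV. fd h i u x t * fd h i (source p q M u) x t)"
  proof -
    have "fd h i (dt u) x t - (\<Sum>j\<in>UNIV. fd h i (dx j (dx j u)) x t) = fd h i (source p q M u) x t" for i
      using eq[OF xt] eq[OF shift[of i]]
      by (simp add: fd_def laplacian_def sum_subtractf flip: sum_divide_distrib diff_divide_distrib)
    then have "(\<Sum>i\<in>UNIV. fd h i u x t * (fd h i (dt u) x t - (\<Sum>j\<in>UNIV. fd h i (dx j (dx j u)) x t)))
       = (\<Sum>i\<in>UNIV. fd h i u x t * fd h i (source p q M u) x t)" by simp
    then show ?thesis
      by (subst sum.swap) (simp add: sum_distrib_left right_diff_distrib sum_subtractf)
  qed
  note src = this
  have e1: "2 * g x t * (\<Sum>i\<in>UNIV. fd h i u x t * fd h i (source p q M u) x t)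
    = 2 * g x t * (\<Sum>i\<in>UNIV. fd h i u x t * fd h i (dt u) x t)
      - 2 * g x t * (\<Sum>j\<in>UNIV. \<Sum>i\<in>UNIV. fd h i u x t * fd h i (dx j (dx j u)) x t)"
    unfolding src[symmetric] by (rule right_diff_distrib)
  have e2: "2 * A * (b - u x t) * source p q M u x t = 2 * A * (b - u x t) * dt u x t - 2 * A * (b - u x t) * laplacian u x t"
    unfolding eq[OF xt, symmetric] by (rule right_diff_distrib)
  show "0 \<le> (gt x t - (\<Sum>j\<in>UNIV. gdd j x t)) * (\<Sum>i\<in>UNIV. (fd h i u x t)\<^sup>2)
      - 4 * (\<Sum>j\<in>UNIV. gd j x t * (\<Sum>i\<in>UNIV. fd h i u x t * fd h i (dx j u) x t))
      - 2 * g x t * (\<Sum>j\<in>UNIV. \<Sum>i\<in>UNIV. (fd h i (dx j u) x t)\<^sup>2)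
      + 2 * g x t * (\<Sum>i\<in>UNIV. fd h i u x t * fd h i (source p q M u) x t)
      - 2 * A * (b - u x t) * source p q M u x t - 2 * A * (\<Sum>j\<in>UNIV. (dx j u x t)\<^sup>2)"
    using sp time unfolding e1 e2 left_diff_distrib by linarith
qed

lemma norm_grad_squared: "(norm (grad u x t))\<^sup>2 = (\<Sum>i\<in>UNIV. (dx i u x t)\<^sup>2)"
  by (simp add: norm_vec_def L2_set_def sum_nonneg grad_def)

lemma source_eq: "source p q M u x t = u x t powr p + M * (\<Sum>i\<in>UNIV. (dx i u x t)\<^sup>2) powr (q / 2)"
proof -
  have "y powr q = (y\<^sup>2) powr (q / 2)" if "y \<ge> 0" for y :: real
  proof (cases "y = 0")
    case False
    then have "y\<^sup>2 = y powr 2" using that by simp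
    then show ?thesis by (simp only: powr_powr) simp
  qed simp
  from this[of "norm (grad u x t)"] show ?thesis by (simp add: source_def norm_grad_squared)
qed

lemma fd_tendsto:
  fixes w :: "real ^ 'n::finite \<Rightarrow> real \<Rightarrow> real"
  assumes "open Q" "(x, t) \<in> Q" "\<And>y s. (y, s) \<in> Q \<Longrightarrow> has_dx i w y s" "continuous_on Q (\<lambda>(x, t). dx i w x t)"
    and "xs \<longlonglongrightarrow> x" "ts \<longlonglongrightarrow> t" "hs \<longlonglongrightarrow> 0" "\<And>n. hs n > 0"
  shows "(\<lambda>n. fd (hs n) i w (xs n) (ts n)) \<longlonglongrightarrow> dx i w x t"
  unfolding fd_def by (rule difference_quotient_tendsto[OF assms])

text \<open>The source depends on derivatives of u only through |grad u|^2, so its difference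
  quotients converge to an expression with at most second derivatives. Positivity of z makes the
  chain rule for z^(q/2) valid in the limit.\<close>

lemma fd_source_tendsto:
  fixes u :: "real ^ 'n::finite \<Rightarrow> real \<Rightarrow> real"
  assumes Q: "open Q" "(x, t) \<in> Q" and C: "C21_on Q u" and p: "p > 1" and q: "q > 0"
    and nonneg: "\<And>y s. (y, s) \<in> Q \<Longrightarrow> u y s \<ge> 0"
    and z: "z = (\<Sum>i\<in>UNIV. (dx i u x t)\<^sup>2)" "z > 0"
    and inQ: "\<And>n. (xs n, ts n) \<in> Q" "\<And>n. (xs n + hs n *\<^sub>R axis i 1, ts n) \<in> Q"
    and xs: "xs \<longlonglongrightarrow> x" and ts: "ts \<longlonglongrightarrow> t" and hs: "hs \<longlonglongrightarrow> 0" "\<And>n. hs n > 0"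
  shows "(\<lambda>n. fd (hs n) i (source p q M u) (xs n) (ts n)) \<longlonglongrightarrow>
    p * u x t powr (p - 1) * dx i u x t
      + M * (q / 2 * z powr (q / 2 - 1) * (\<Sum>j\<in>UNIV. 2 * dx j u x t * dx i (dx j u) x t))"
proof -
  let ?xs = "\<lambda>n. xs n + hs n *\<^sub>R axis i 1"
  define Z where "Z y s = (\<Sum>j\<in>UNIV. (dx j u y s)\<^sup>2)" for y s
  have cu: "continuous_on Q (\<lambda>(x, t). u x t)" "\<And>j. continuous_on Q (\<lambda>(x, t). dx j u x t)"
    "\<And>i j. continuous_on Q (\<lambda>(x, t). dx i (dx j u) x t)"
    and du: "\<And>y s j. (y, s) \<in> Q \<Longrightarrow> has_dx j u y s" "\<And>y s i j. (y, s) \<in> Q \<Longrightarrow> has_dx i (dx j u) y s"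
    using C unfolding C21_on_def by blast+
  have "?xs \<longlonglongrightarrow> x + 0 *\<^sub>R axis i 1" by (intro tendsto_intros xs hs)
  then have xs': "?xs \<longlonglongrightarrow> x" by simp
  have P: "(\<lambda>n. dx j u (xs n) (ts n)) \<longlonglongrightarrow> dx j u x t" "(\<lambda>n. dx j u (?xs n) (ts n)) \<longlonglongrightarrow> dx j u x t" for j
    by (intro tendsto_within_open[OF Q cu(2)] xs xs' ts)+
  have "(\<lambda>n. (\<Sum>j\<in>UNIV. fd (hs n) i (dx j u) (xs n) (ts n) * (dx j u (?xs n) (ts n) + dx j u (xs n) (ts n))))
      \<longlonglongrightarrow> (\<Sum>j\<in>UNIV. dx i (dx j u) x t * (dx j u x t + dx j u x t))"
    by (intro tendsto_sum tendsto_mult tendsto_add P fd_tendsto[OF Q du(2) cu(3) xs ts hs])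
  \<comment> \<open>A difference of squares factors, which reduces the quotient of |grad u|^2 to
    quotients of the components \<open>dx j u\<close>.\<close>
  moreover have "(Z (?xs n) (ts n) - Z (xs n) (ts n)) / hs n
      = (\<Sum>j\<in>UNIV. fd (hs n) i (dx j u) (xs n) (ts n) * (dx j u (?xs n) (ts n) + dx j u (xs n) (ts n)))" for n
    by (simp add: Z_def fd_def power2_eq_square square_diff_square_factored mult_ac flip: sum_subtractf sum_divide_distrib)
  moreover have "(\<Sum>j\<in>UNIV. dx i (dx j u) x t * (dx j u x t + dx j u x t)) = (\<Sum>j\<in>UNIV. 2 * dx j u x t * dx i (dx j u) x t)"
    by (intro sum.cong refl) (simp add: algebra_simps)
  ultimately have dZ: "(\<lambda>n. (Z (?xs n) (ts n) - Z (xs n) (ts n)) / hs n) \<longlonglongrightarrow> (\<Sum>j\<in>UNIV. 2 * dx j u x t * dx i (dx j u) x t)"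
    by simp
  have Z: "(\<lambda>n. Z (xs n) (ts n)) \<longlonglongrightarrow> z" "(\<lambda>n. Z (?xs n) (ts n)) \<longlonglongrightarrow> z"
    unfolding Z_def z(1) by (intro tendsto_sum tendsto_power P)+
  have Z0: "Z y s \<ge> 0" for y s by (simp add: Z_def sum_nonneg)
  have 1: "(\<lambda>n. (Z (?xs n) (ts n) powr (q / 2) - Z (xs n) (ts n) powr (q / 2)) / hs n) \<longlonglongrightarrow>
      q / 2 * z powr (q / 2 - 1) * (\<Sum>j\<in>UNIV. 2 * dx j u x t * dx i (dx j u) x t)"
    by (rule powr_difference_quotient_tendsto[OF _ _ _ Z(2) Z(1) dZ]) (use q z Z0 in auto)
  have 2: "(\<lambda>n. (u (?xs n) (ts n) powr p - u (xs n) (ts n) powr p) / hs n) \<longlonglongrightarrow> p * u x t powr (p - 1) * dx i u x t"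
  proof (rule powr_difference_quotient_tendsto)
    show "(\<lambda>n. u (?xs n) (ts n)) \<longlonglongrightarrow> u x t" "(\<lambda>n. u (xs n) (ts n)) \<longlonglongrightarrow> u x t"
      by (intro tendsto_within_open[OF Q cu(1)] xs xs' ts)+
    show "(\<lambda>n. (u (?xs n) (ts n) - u (xs n) (ts n)) / hs n) \<longlonglongrightarrow> dx i u x t"
      by (rule difference_quotient_tendsto[OF Q du(1) cu(2) xs ts hs])
  qed (use p nonneg inQ in auto)
  have "fd (hs n) i (source p q M u) (xs n) (ts n) =
      (u (?xs n) (ts n) powr p - u (xs n) (ts n) powr p) / hs n
      + M * ((Z (?xs n) (ts n) powr (q / 2) - Z (xs n) (ts n) powr (q / 2)) / hs n)" for n
    by (simp add: fd_def source_eq Z_def add_divide_distrib diff_divide_distrib algebra_simps)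
  with tendsto_add[OF 2 tendsto_mult_left[OF 1, of M]] show ?thesis by simp
qed

lemma cutoff_tendsto:
  fixes c :: "real ^ 'n::finite"
  assumes "r > 0" "xs \<longlonglongrightarrow> x" "ts \<longlonglongrightarrow> t"
  shows "(\<lambda>n. cutoff c r \<tau> (xs n) (ts n)) \<longlonglongrightarrow> cutoff c r \<tau> x t"
    and "(\<lambda>n. cutoff_dx c r \<tau> j (xs n) (ts n)) \<longlonglongrightarrow> cutoff_dx c r \<tau> j x t"
    and "(\<lambda>n. cutoff_dxx c r \<tau> j (xs n) (ts n)) \<longlonglongrightarrow> cutoff_dxx c r \<tau> j x t"
  unfolding cutoff_def cutoff_dx_def cutoff_dxx_def
  by (intro tendsto_intros assms(2,3); use assms(1) in simp)+

text \<open>The maximum is taken over radius r, but the quotients also look at points shifted by h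
  \<le> r; hence radius 2r in \<open>sub\<close>.\<close>

lemma bernstein_attains_max:
  fixes u :: "real ^ 'n::finite \<Rightarrow> real \<Rightarrow> real"
  assumes r: "r > 0" and \<tau>: "\<tau> \<le> t1" and cont: "continuous_on Q (\<lambda>(x, t). u x t)"
    and sub: "cball c (2 * r) \<times> {\<tau>..t1} \<subseteq> Q" and h: "0 < h" "h \<le> r"
  shows "\<exists>x\<in>cball c r. \<exists>t\<in>{\<tau>..t1}. \<forall>y\<in>cball c r. \<forall>s\<in>{\<tau>..t1}.
    bernstein (\<lambda>x t. cutoff c r \<tau> x t ^ k) A b u h y s \<le> bernstein (\<lambda>x t. cutoff c r \<tau> x t ^ k) A b u h x t"
proof -
  let ?K = "cball c r \<times> {\<tau>..t1}"
  have sh: "(y + v, s) \<in> Q" if "(y, s) \<in> ?K" "norm v \<le> r" for y s v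
  proof -
    have "norm (c - (y + v)) \<le> norm (c - y) + norm v" using norm_triangle_ineq4[of "c - y" v] by (simp add: algebra_simps)
    then show ?thesis using that sub by (auto simp: dist_norm subset_iff)
  qed
  have cu: "continuous_on ?K (\<lambda>z. u (fst z + v) (snd z))" if "norm v \<le> r" for v
  proof -
    have "continuous_on ?K (\<lambda>z. (\<lambda>(x, t). u x t) (fst z + v, snd z))"
      by (rule continuous_on_compose2[OF cont]) (use sh[OF _ that] in \<open>auto intro!: continuous_intros\<close>)
    then show ?thesis by simp
  qed
  have cu0: "continuous_on ?K (\<lambda>z. u (fst z) (snd z))" using cu[of 0] r by simp
  have "continuous_on ?K (\<lambda>z. bernstein (\<lambda>x t. cutoff c r \<tau> x t ^ k) A b u h (fst z) (snd z))"
    unfolding bernstein_def fd_def cutoff_def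
    by (intro continuous_intros cu cu0) (use h r in auto)
  moreover have "compact ?K" "?K \<noteq> {}" using r \<tau> by (auto intro: compact_Times)
  ultimately obtain z where "z \<in> ?K" "\<forall>w\<in>?K. bernstein (\<lambda>x t. cutoff c r \<tau> x t ^ k) A b u h (fst w) (snd w)
      \<le> bernstein (\<lambda>x t. cutoff c r \<tau> x t ^ k) A b u h (fst z) (snd z)"
    using continuous_attains_sup by blast
  then show ?thesis by (intro bexI[of _ "fst z"] bexI[of _ "snd z"]) auto
qed

subsection \<open>The gradient estimates\<close>

text \<open>\<open>\<rho>\<close> and \<open>z\<close> are the cut-off and |grad u|^2 at a limit of
  maximum points as h tends to 0. At (c, t1) the cut-off equals t1 - \<tau>, so comparing values
  there bounds the gradient at the centre. \<open>big\<close> rules out the case in which the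
  estimate for A > 0 is immediate.\<close>

lemma bernstein_estimate:
  fixes u :: "real ^ 'n::finite \<Rightarrow> real \<Rightarrow> real"
  assumes p: "p > 1" and q: "q = 2 * p / (p + 1)" and M: "M \<ge> M0 CARD('n) p"
    and Q: "open Q" and sol: "classical_solution p q M Q u"
    and bounds: "\<And>x t. (x, t) \<in> Q \<Longrightarrow> 0 \<le> u x t \<and> u x t \<le> b \<and> dt u x t \<le> 0"
    and r: "r > 0" and \<tau>: "\<tau> < t1" and sub: "cball c (2 * r) \<times> {\<tau>..t1} \<subseteq> Q"
    and A: "A \<ge> 0" and k: "k \<ge> 2"
    and big: "(3 + 4 * real CARD('n)) * A * b\<^sup>2 < (t1 - \<tau>) ^ k * (norm (grad u c t1))\<^sup>2"
  obtains \<rho> z where "0 < \<rho>" "\<rho> \<le> t1 - \<tau>" "0 < z"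
    "(t1 - \<tau>) ^ k * (norm (grad u c t1))\<^sup>2 \<le> \<rho> ^ k * z + A * b\<^sup>2"
    "A + M\<^sup>2 / (2 * real CARD('n)) * \<rho> ^ k * z powr (q - 1)
      \<le> (k + 4 * real CARD('n) * k + 64 * (1 + real CARD('n)) * (real k)\<^sup>2) * \<rho> ^ (k - 1) * (1 + (t1 - \<tau>) / r\<^sup>2)"
proof -
  let ?N = "real CARD('n)"
  define g where "g x t = cutoff c r \<tau> x t ^ k" for x :: "real ^ 'n" and t
  define gd where "gd j x t = k * cutoff c r \<tau> x t ^ (k - 1) * cutoff_dx c r \<tau> j x t" for j and x :: "real ^ 'n" and t
  define gdd where "gdd j x t = k * (real (k - 1) * cutoff c r \<tau> x t ^ (k - 2) * (cutoff_dx c r \<tau> j x t)\<^sup>2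
      + cutoff c r \<tau> x t ^ (k - 1) * cutoff_dxx c r \<tau> j x t)" for j and x :: "real ^ 'n" and t
  define gt where "gt x t = k * cutoff c r \<tau> x t ^ (k - 1) * (1 - (norm (x - c))\<^sup>2 / r\<^sup>2)\<^sup>2" for x :: "real ^ 'n" and t
  define W where "W = bernstein g A b u"
  define h where "h n = r / (real n + 1)" for n
  have C: "C21_on Q u" using sol by (simp add: classical_solution_def)
  have cu: "continuous_on Q (\<lambda>(x, t). u x t)" "\<And>j. continuous_on Q (\<lambda>(x, t). dx j u x t)"
    "\<And>i j. continuous_on Q (\<lambda>(x, t). dx i (dx j u) x t)"
    and du: "\<And>y s j. (y, s) \<in> Q \<Longrightarrow> has_dx j u y s" "\<And>y s i j. (y, s) \<in> Q \<Longrightarrow> has_dx i (dx j u) y s"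
    using C unfolding C21_on_def by blast+
  have eq: "dt u x t - laplacian u x t = source p q M u x t" if "(x, t) \<in> Q" for x t
    using sol that unfolding classical_solution_def source_def by blast
  have qpos: "q > 0" using p by (simp add: q)
  have h: "h n > 0" "h n \<le> r" for n using r by (auto simp: h_def divide_simps)
  have h0: "h \<longlonglongrightarrow> 0"
    unfolding h_def using tendsto_mult_left[OF LIMSEQ_inverse_real_of_nat, of r]
    by (simp add: divide_inverse add.commute)
  have "\<exists>x t. x \<in> cball c r \<and> t \<in> {\<tau>..t1} \<and> (\<forall>y\<in>cball c r. \<forall>s\<in>{\<tau>..t1}. W (h n) y s \<le> W (h n) x t)" for n
    using bernstein_attains_max[OF r less_imp_le[OF \<tau>] cu(1) sub h] unfolding W_def g_def by blast
  then obtain X S where XS: "\<And>n. X n \<in> cball c r" "\<And>n. S n \<in> {\<tau>..t1}"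
    "\<And>n y s. y \<in> cball c r \<Longrightarrow> s \<in> {\<tau>..t1} \<Longrightarrow> W (h n) y s \<le> W (h n) (X n) (S n)" by metis
  have "seq_compact (cball c r \<times> {\<tau>..t1})"
    by (intro compact_imp_seq_compact compact_Times) auto
  moreover have "\<forall>n. (X n, S n) \<in> cball c r \<times> {\<tau>..t1}" using XS by blast
  ultimately obtain l \<phi> where l: "l \<in> cball c r \<times> {\<tau>..t1}" "strict_mono \<phi>" "((\<lambda>n. (X n, S n)) \<circ> \<phi>) \<longlonglongrightarrow> l"
    by (rule seq_compactE)
  define x t xs ts hs where "x = fst l" and "t = snd l" and "xs = X \<circ> \<phi>" and "ts = S \<circ> \<phi>" and "hs = h \<circ> \<phi>"
  have xt: "x \<in> cball c r" "t \<in> {\<tau>..t1}" using l(1) by (auto simp: x_def t_def)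
  have xs: "xs \<longlonglongrightarrow> x" using tendsto_fst[OF l(3)] by (simp add: x_def xs_def o_def)
  have ts: "ts \<longlonglongrightarrow> t" using tendsto_snd[OF l(3)] by (simp add: t_def ts_def o_def)
  have hs: "hs \<longlonglongrightarrow> 0" "\<And>n. hs n > 0" "\<And>n. hs n \<le> r"
    using LIMSEQ_subseq_LIMSEQ[OF h0 l(2)] h by (auto simp: hs_def)
  have K: "xs n \<in> cball c r" "ts n \<in> {\<tau>..t1}" for n using XS by (auto simp: xs_def ts_def)
  have max: "W (hs n) y s \<le> W (hs n) (xs n) (ts n)" if "y \<in> cball c r" "s \<in> {\<tau>..t1}" for n y s
    using XS(3)[OF that] by (simp add: xs_def ts_def hs_def)
  have KQ: "(y, s) \<in> Q" if "y \<in> cball c r" "s \<in> {\<tau>..t1}" for y s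
    using sub that r by (auto simp: subset_iff)
  have shift: "(y + e *\<^sub>R axis i 1, s) \<in> Q" if "y \<in> cball c r" "s \<in> {\<tau>..t1}" "0 < e" "e \<le> r" for y s i e
  proof -
    have "norm (c - (y + e *\<^sub>R axis i 1)) \<le> norm (c - y) + norm (e *\<^sub>R axis i (1::real))"
      using norm_triangle_ineq4[of "c - y" "e *\<^sub>R axis i 1"] by (simp add: algebra_simps)
    then show ?thesis using that sub by (auto simp: dist_norm subset_iff)
  qed
  note xQ = KQ[OF xt]
  define z where "z = (\<Sum>i\<in>UNIV. (dx i u x t)\<^sup>2)"
  have P: "(\<lambda>n. fd (hs n) i u (xs n) (ts n)) \<longlonglongrightarrow> dx i u x t" for i
    by (rule fd_tendsto[OF Q xQ du(1) cu(2) xs ts hs(1,2)])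
  have H: "(\<lambda>n. fd (hs n) i (dx j u) (xs n) (ts n)) \<longlonglongrightarrow> dx i (dx j u) x t" for i j
    by (rule fd_tendsto[OF Q xQ du(2) cu(3) xs ts hs(1,2)])
  have U: "(\<lambda>n. u (xs n) (ts n)) \<longlonglongrightarrow> u x t" by (rule tendsto_within_open[OF Q xQ cu(1) xs ts])
  have P': "(\<lambda>n. dx j u (xs n) (ts n)) \<longlonglongrightarrow> dx j u x t" for j by (rule tendsto_within_open[OF Q xQ cu(2) xs ts])
  have P0: "(\<lambda>n. fd (hs n) i u c t1) \<longlonglongrightarrow> dx i u c t1" for i
    using r \<tau> by (intro fd_tendsto[OF Q KQ du(1) cu(2) tendsto_const tendsto_const hs(1,2)]) auto
  note ct = cutoff_tendsto[OF r xs ts]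
  have g: "(\<lambda>n. g (xs n) (ts n)) \<longlonglongrightarrow> g x t" and gd: "(\<lambda>n. gd j (xs n) (ts n)) \<longlonglongrightarrow> gd j x t"
    and gdd: "(\<lambda>n. gdd j (xs n) (ts n)) \<longlonglongrightarrow> gdd j x t" and gt: "(\<lambda>n. gt (xs n) (ts n)) \<longlonglongrightarrow> gt x t" for j
    unfolding g_def gd_def gdd_def gt_def
    by (intro tendsto_intros ct xs; use r in simp)+
  have "(\<lambda>n. W (hs n) (xs n) (ts n)) \<longlonglongrightarrow> g x t * z + A * (b - u x t)\<^sup>2"
    unfolding W_def bernstein_def z_def by (intro tendsto_intros g P U)
  moreover have "(\<lambda>n. W (hs n) c t1) \<longlonglongrightarrow> g c t1 * (norm (grad u c t1))\<^sup>2 + A * (b - u c t1)\<^sup>2"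
    unfolding W_def bernstein_def norm_grad_squared by (intro tendsto_intros P0)
  moreover have "W (hs n) c t1 \<le> W (hs n) (xs n) (ts n)" for n using r \<tau> by (intro max) auto
  ultimately have "g c t1 * (norm (grad u c t1))\<^sup>2 + A * (b - u c t1)\<^sup>2 \<le> g x t * z + A * (b - u x t)\<^sup>2"
    by (meson LIMSEQ_le)
  moreover have "g c t1 = (t1 - \<tau>) ^ k" by (simp add: g_def cutoff_def)
  moreover have "0 \<le> A * (b - u c t1)\<^sup>2" using A by simp
  moreover have ub: "0 \<le> u x t" "u x t \<le> b" "dt u x t \<le> 0" using bounds[OF xQ] by auto
  then have "A * (b - u x t)\<^sup>2 \<le> A * b\<^sup>2" using A by (intro mult_left_mono power_mono) auto
  ultimately have le: "(t1 - \<tau>) ^ k * (norm (grad u c t1))\<^sup>2 \<le> g x t * z + A * b\<^sup>2" by simp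
  \<comment> \<open>One of the 3 + 4N copies of A b^2 is spent on (b - u)^2 at the maximum; 2 + 4N
    remain, as \<open>bernstein_algebra\<close> requires.\<close>
  have bigz: "(2 + 4 * ?N) * A * b\<^sup>2 < g x t * z"
    using le big by (simp add: algebra_simps)
  moreover have "0 \<le> (2 + 4 * ?N) * A * b\<^sup>2" using A by simp
  ultimately have gz: "0 < g x t * z" by linarith
  have z0: "z \<ge> 0" by (simp add: z_def sum_nonneg)
  with gz have z: "z > 0" by (cases "z = 0") auto
  have g_pos: "g x t > 0" using gz z by (simp add: zero_less_mult_iff)
  \<comment> \<open>A positive weight excludes the initial time and the lateral boundary, where the
    cut-off vanishes.\<close>
  have "cutoff c r \<tau> x t \<ge> 0" using xt by (simp add: cutoff_def)
  moreover have "cutoff c r \<tau> x t \<noteq> 0" using g_pos k by (auto simp: g_def power_0_left)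
  ultimately have \<rho>: "cutoff c r \<tau> x t > 0" by simp
  have t: "\<tau> < t" "t \<le> t1" using xt \<rho> by (auto simp: cutoff_def less_le)
  have "norm (x - c) \<noteq> r" using \<rho> r by (auto simp: cutoff_def)
  moreover have "norm (x - c) \<le> r" using xt by (simp add: dist_norm norm_minus_commute)
  ultimately have x: "norm (x - c) < r" by simp
  have "(norm (x - c))\<^sup>2 / r\<^sup>2 \<le> 1" using x r by (simp add: power_mono)
  then have "cutoff c r \<tau> x t \<le> (t - \<tau>) * 1"
    unfolding cutoff_def using t by (intro mult_left_mono power_le_one) auto
  then have \<rho>_le: "cutoff c r \<tau> x t \<le> t1 - \<tau>" using t by simp
  have "(\<lambda>n. norm (xs n - c)) \<longlonglongrightarrow> norm (x - c)" by (intro tendsto_intros xs)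
  from order_tendstoD(2)[OF this x] order_tendstoD(1)[OF ts t(1)]
  have ev: "\<forall>\<^sub>F n in sequentially. norm (xs n - c) < r \<and> \<tau> < ts n" by (rule eventually_conj)
  have ineq: "(\<forall>j. gd j (xs n) (ts n) * (\<Sum>i\<in>UNIV. (fd (hs n) i u (xs n) (ts n))\<^sup>2)
        + 2 * g (xs n) (ts n) * (\<Sum>i\<in>UNIV. fd (hs n) i u (xs n) (ts n) * fd (hs n) i (dx j u) (xs n) (ts n))
        - 2 * A * (b - u (xs n) (ts n)) * dx j u (xs n) (ts n) = 0) \<and>
      0 \<le> (gt (xs n) (ts n) - (\<Sum>j\<in>UNIV. gdd j (xs n) (ts n))) * (\<Sum>i\<in>UNIV. (fd (hs n) i u (xs n) (ts n))\<^sup>2)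
      - 4 * (\<Sum>j\<in>UNIV. gd j (xs n) (ts n) * (\<Sum>i\<in>UNIV. fd (hs n) i u (xs n) (ts n) * fd (hs n) i (dx j u) (xs n) (ts n)))
      - 2 * g (xs n) (ts n) * (\<Sum>j\<in>UNIV. \<Sum>i\<in>UNIV. (fd (hs n) i (dx j u) (xs n) (ts n))\<^sup>2)
      + 2 * g (xs n) (ts n) * (\<Sum>i\<in>UNIV. fd (hs n) i u (xs n) (ts n) * fd (hs n) i (source p q M u) (xs n) (ts n))
      - 2 * A * (b - u (xs n) (ts n)) * (u (xs n) (ts n) powr p + M * (\<Sum>i\<in>UNIV. (dx i u (xs n) (ts n))\<^sup>2) powr (q / 2))
      - 2 * A * (\<Sum>j\<in>UNIV. (dx j u (xs n) (ts n))\<^sup>2)"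
    if n: "norm (xs n - c) < r \<and> \<tau> < ts n" for n
  proof -
    \<comment> \<open>The ball of radius \<delta> and the times just before \<open>ts n\<close> stay
      inside the set over which the maximum was taken; \<open>ts n\<close> = t1 remains
      possible.\<close>
    define \<delta> where "\<delta> = min (r - norm (xs n - c)) (ts n - \<tau>)"
    have \<delta>: "\<delta> > 0" using n by (simp add: \<delta>_def)
    have m: "bernstein g A b u (hs n) y s \<le> bernstein g A b u (hs n) (xs n) (ts n)"
      if "dist y (xs n) < \<delta>" "ts n - \<delta> < s" "s \<le> ts n" for y s
    proof -
      have "norm (y - c) \<le> norm (y - xs n) + norm (xs n - c)" using norm_triangle_ineq[of "y - xs n" "xs n - c"] by simp
      then have "y \<in> cball c r" using that(1) by (simp add: \<delta>_def dist_norm norm_minus_commute)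
      moreover have "s \<in> {\<tau>..t1}" using that K(2)[of n] by (auto simp: \<delta>_def)
      ultimately show ?thesis using max unfolding W_def by blast
    qed
    note * = finite_difference_inequality[where gd = gd and gdd = gdd and gt = gt and g = g,
        OF Q sol KQ[OF K] shift[OF K hs(2,3)] _ _ _ \<delta> m]
    have g1: "((\<lambda>s. g (xs n + s *\<^sub>R axis j 1) (ts n)) has_real_derivative gd j (xs n + s *\<^sub>R axis j 1) (ts n)) (at s)"
      and g2: "((\<lambda>s. gd j (xs n + s *\<^sub>R axis j 1) (ts n)) has_real_derivative gdd j (xs n) (ts n)) (at 0)"
      and g3: "((\<lambda>s. g (xs n) s) has_real_derivative gt (xs n) (ts n)) (at (ts n))" for j s
      unfolding g_def gd_def gdd_def gt_def by (rule cutoff_power_deriv[OF r])+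
    show ?thesis using *[OF g1 g2 g3] by (simp add: source_eq)
  qed
  have first: "gd j x t * z + 2 * g x t * (\<Sum>i\<in>UNIV. dx i u x t * dx i (dx j u) x t) - 2 * A * (b - u x t) * dx j u x t = 0" for j
  proof (rule LIMSEQ_unique)
    show "(\<lambda>n. gd j (xs n) (ts n) * (\<Sum>i\<in>UNIV. (fd (hs n) i u (xs n) (ts n))\<^sup>2)
        + 2 * g (xs n) (ts n) * (\<Sum>i\<in>UNIV. fd (hs n) i u (xs n) (ts n) * fd (hs n) i (dx j u) (xs n) (ts n))
        - 2 * A * (b - u (xs n) (ts n)) * dx j u (xs n) (ts n)) \<longlonglongrightarrow> 
        gd j x t * z + 2 * g x t * (\<Sum>i\<in>UNIV. dx i u x t * dx i (dx j u) x t) - 2 * A * (b - u x t) * dx j u x t"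
      (is "?f \<longlonglongrightarrow> _")
      unfolding z_def by (intro tendsto_intros gd g P H U P')
    have "\<forall>\<^sub>F n in sequentially. 0 = ?f n" using ev by eventually_elim (use ineq in auto)
    from Lim_transform_eventually[OF tendsto_const this] show "?f \<longlonglongrightarrow> 0" .
  qed
  have Sc: "(\<lambda>n. fd (hs n) i (source p q M u) (xs n) (ts n)) \<longlonglongrightarrow> p * u x t powr (p - 1) * dx i u x t
      + M * (q / 2 * z powr (q / 2 - 1) * (\<Sum>j\<in>UNIV. 2 * dx j u x t * dx i (dx j u) x t))" for i
    by (rule fd_source_tendsto[OF Q xQ C p qpos _ z_def z KQ[OF K] shift[OF K hs(2,3)] xs ts hs(1,2)])
      (use bounds in auto)
  have ZL: "(\<lambda>n. (\<Sum>i\<in>UNIV. (dx i u (xs n) (ts n))\<^sup>2)) \<longlonglongrightarrow> z" unfolding z_def by (intro tendsto_intros P')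
  have fdZ: "(\<lambda>n. (\<Sum>i\<in>UNIV. (fd (hs n) i u (xs n) (ts n))\<^sup>2)) \<longlonglongrightarrow> z" unfolding z_def by (intro tendsto_intros P)
  have uQ: "0 \<le> u (xs n) (ts n)" for n using bounds[OF KQ[OF K]] by blast
  have Up: "(\<lambda>n. u (xs n) (ts n) powr p) \<longlonglongrightarrow> u x t powr p"
    using p uQ by (intro tendsto_powr'[OF U tendsto_const]) auto
  have Zp: "(\<lambda>n. (\<Sum>i\<in>UNIV. (dx i u (xs n) (ts n))\<^sup>2) powr (q / 2)) \<longlonglongrightarrow> z powr (q / 2)"
    using z by (intro tendsto_powr ZL tendsto_const) auto
  have second: "0 \<le> (gt x t - (\<Sum>j\<in>UNIV. gdd j x t)) * z
      - 4 * (\<Sum>j\<in>UNIV. gd j x t * (\<Sum>i\<in>UNIV. dx i u x t * dx i (dx j u) x t))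
      - 2 * g x t * (\<Sum>j\<in>UNIV. \<Sum>i\<in>UNIV. (dx i (dx j u) x t)\<^sup>2)
      + 2 * g x t * (\<Sum>i\<in>UNIV. dx i u x t * (p * u x t powr (p - 1) * dx i u x t
      + M * (q / 2 * z powr (q / 2 - 1) * (\<Sum>j\<in>UNIV. 2 * dx j u x t * dx i (dx j u) x t))))
      - 2 * A * (b - u x t) * (u x t powr p + M * z powr (q / 2)) - 2 * A * z"
  proof (rule tendsto_lowerbound)
    show "(\<lambda>n. (gt (xs n) (ts n) - (\<Sum>j\<in>UNIV. gdd j (xs n) (ts n))) * (\<Sum>i\<in>UNIV. (fd (hs n) i u (xs n) (ts n))\<^sup>2)
      - 4 * (\<Sum>j\<in>UNIV. gd j (xs n) (ts n) * (\<Sum>i\<in>UNIV. fd (hs n) i u (xs n) (ts n) * fd (hs n) i (dx j u) (xs n) (ts n)))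
      - 2 * g (xs n) (ts n) * (\<Sum>j\<in>UNIV. \<Sum>i\<in>UNIV. (fd (hs n) i (dx j u) (xs n) (ts n))\<^sup>2)
      + 2 * g (xs n) (ts n) * (\<Sum>i\<in>UNIV. fd (hs n) i u (xs n) (ts n) * fd (hs n) i (source p q M u) (xs n) (ts n))
      - 2 * A * (b - u (xs n) (ts n)) * (u (xs n) (ts n) powr p + M * (\<Sum>i\<in>UNIV. (dx i u (xs n) (ts n))\<^sup>2) powr (q / 2))
      - 2 * A * (\<Sum>j\<in>UNIV. (dx j u (xs n) (ts n))\<^sup>2)) \<longlonglongrightarrow> 
      (gt x t - (\<Sum>j\<in>UNIV. gdd j x t)) * z
      - 4 * (\<Sum>j\<in>UNIV. gd j x t * (\<Sum>i\<in>UNIV. dx i u x t * dx i (dx j u) x t))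
      - 2 * g x t * (\<Sum>j\<in>UNIV. \<Sum>i\<in>UNIV. (dx i (dx j u) x t)\<^sup>2)
      + 2 * g x t * (\<Sum>i\<in>UNIV. dx i u x t * (p * u x t powr (p - 1) * dx i u x t
      + M * (q / 2 * z powr (q / 2 - 1) * (\<Sum>j\<in>UNIV. 2 * dx j u x t * dx i (dx j u) x t))))
      - 2 * A * (b - u x t) * (u x t powr p + M * z powr (q / 2)) - 2 * A * z" (is "?f \<longlonglongrightarrow> _")
      by (intro tendsto_add tendsto_diff tendsto_mult gt g fdZ Zp Up U ZL tendsto_const)
        (intro tendsto_sum tendsto_mult tendsto_power gdd gd P H Sc)+
    show "\<forall>\<^sub>F n in sequentially. 0 \<le> ?f n" using ev by eventually_elim (use ineq in blast)
  qed simp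
  have trace: "u x t powr p + M * z powr (q / 2) \<le> - (\<Sum>i\<in>UNIV. dx i (dx i u) x t)"
    using eq[OF xQ] ub(3) by (simp add: laplacian_def source_eq z_def)
  have "A + M\<^sup>2 / (2 * ?N) * g x t * z powr (q - 1)
      \<le> (gt x t - (\<Sum>j\<in>UNIV. gdd j x t)) + (4 + 4 * ?N) * (\<Sum>j\<in>UNIV. (gd j x t)\<^sup>2) / g x t"
    by (rule bernstein_algebra[where P = "\<lambda>i. dx i u x t" and H = "\<lambda>i j. dx i (dx j u) x t",
        OF p q M A ub(1,2) z_def z g_pos first trace second]) (use bigz in simp)
  also have "\<dots> \<le> (k + 4 * ?N * k + 64 * (1 + ?N) * (real k)\<^sup>2) * cutoff c r \<tau> x t ^ (k - 1) * (1 + (t1 - \<tau>) / r\<^sup>2)"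
    unfolding g_def gd_def gdd_def gt_def
    by (rule cutoff_heat_bound[OF r x t(1) _ k]) (use t in simp)
  finally show ?thesis
    using that[OF \<rho> \<rho>_le z] le unfolding g_def by simp
qed

section \<open>Evaluation for A = 0 and for A > 0\<close>

text \<open>For A = 0 the factor \<rho>^(k-1) cancels and the power \<gamma> = 1/(q-1) isolates
  \<rho>^\<gamma> z, without b. For A > 0 the term A alone contradicts the inequality at the
  maximum, so \<open>big\<close> must fail, and its failure is the second bound.\<close>

lemma bernstein_estimates:
  fixes u :: "real ^ 'n::finite \<Rightarrow> real \<Rightarrow> real"
  assumes p: "p > 1" and q: "q = 2 * p / (p + 1)" and M: "M \<ge> M0 CARD('n) p"
    and Q: "open Q" and sol: "classical_solution p q M Q u"
    and bounds: "\<And>x t. (x, t) \<in> Q \<Longrightarrow> 0 \<le> u x t \<and> u x t \<le> b \<and> dt u x t \<le> 0"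
    and r: "r > 0" and T: "0 < T" and sub: "cball c (2 * r) \<times> {t - T..t} \<subseteq> Q"
    and k: "k \<ge> 2" and \<gamma>: "\<gamma> = (p + 1) / (p - 1)" and k\<gamma>: "\<gamma> \<le> real k"
    and C1: "C1 = k + 4 * real CARD('n) * k + 64 * (1 + real CARD('n)) * (real k)\<^sup>2"
  shows "(norm (grad u c t))\<^sup>2 \<le> (2 * real CARD('n) * C1 / M\<^sup>2 * (1 / T + 1 / r\<^sup>2)) powr \<gamma>"
    and "(norm (grad u c t))\<^sup>2 \<le> 2 * (3 + 4 * real CARD('n)) * C1 * b\<^sup>2 * (1 / T + 1 / r\<^sup>2)"
proof -
  let ?N = "real CARD('n)" and ?z = "(norm (grad u c t))\<^sup>2" and ?E = "1 + T / r\<^sup>2"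
  have N: "?N > 0" by simp
  have "0 < M0 CARD('n) p" using p by (simp add: M0_def)
  with M have M_pos: "M > 0" by linarith
  have C1_pos: "C1 > 0" using k unfolding C1 by (intro add_pos_nonneg) auto
  have E: "?E > 0" using T by (intro add_pos_nonneg) auto
  have "q - 1 = (p - 1) / (p + 1)" using p by (simp add: q field_simps)
  then have \<gamma>_pos: "\<gamma> > 0" and q\<gamma>: "(q - 1) * \<gamma> = 1" using p by (simp_all add: \<gamma>)
  have ET: "?E / T = 1 / T + 1 / r\<^sup>2" using T r by (simp add: field_simps)
  have tT: "t - (t - T) = T" "t - T < t" using T by auto
  note est = bernstein_estimate[OF p q M Q sol bounds r tT(2) sub _ k, unfolded tT(1), folded C1]
  show "?z \<le> (2 * ?N * C1 / M\<^sup>2 * (1 / T + 1 / r\<^sup>2)) powr \<gamma>"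
  proof (cases "?z = 0")
    case False
    then have "0 < T ^ k * ?z" using T by simp
    then have "(3 + 4 * ?N) * 0 * b\<^sup>2 < T ^ k * ?z" by simp
    then obtain \<rho> z where \<rho>: "0 < \<rho>" "\<rho> \<le> T" and z: "0 < z" and 1: "T ^ k * ?z \<le> \<rho> ^ k * z + 0 * b\<^sup>2"
      and 2: "0 + M\<^sup>2 / (2 * ?N) * \<rho> ^ k * z powr (q - 1) \<le> C1 * \<rho> ^ (k - 1) * ?E"
      using est[of 0] by auto
    define D where "D = 2 * ?N * C1 / M\<^sup>2 * ?E"
    have D: "D > 0" unfolding D_def using N C1_pos M_pos E by simp
    have k1: "\<rho> ^ k = \<rho> ^ (k - 1) * \<rho>" using k by (cases k) auto
    have "\<rho> ^ (k - 1) * (M\<^sup>2 / (2 * ?N) * (\<rho> * z powr (q - 1))) \<le> \<rho> ^ (k - 1) * (C1 * ?E)"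
      using 2 by (simp add: k1 mult_ac)
    then have "M\<^sup>2 / (2 * ?N) * (\<rho> * z powr (q - 1)) \<le> C1 * ?E"
      using \<rho>(1) by (simp only: mult_le_cancel_left_pos zero_less_power)
    then have "\<rho> * z powr (q - 1) \<le> D"
      using M_pos N by (simp add: D_def field_simps)
    then have "(\<rho> * z powr (q - 1)) powr \<gamma> \<le> D powr \<gamma>"
      using \<rho> \<gamma>_pos by (intro powr_mono2) auto
    then have 3: "\<rho> powr \<gamma> * z \<le> D powr \<gamma>"
      using \<rho> z by (simp add: powr_mult powr_powr q\<gamma>)
    \<comment> \<open>Since k \<ge> \<gamma>, the surplus power \<rho>^(k-\<gamma>) can be raised to
      T^(k-\<gamma>) and then cancelled.\<close>
    have kp: "s ^ k = s powr (k - \<gamma>) * s powr \<gamma>" if "s > 0" for s :: real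
      using that by (simp add: powr_realpow flip: powr_add)
    have "T ^ k * ?z \<le> \<rho> powr (k - \<gamma>) * (\<rho> powr \<gamma> * z)" using 1 kp[OF \<rho>(1)] by simp
    also have "\<dots> \<le> T powr (k - \<gamma>) * D powr \<gamma>"
      using 3 \<rho> z k\<gamma> by (intro mult_mono powr_mono2) auto
    finally have "T powr (k - \<gamma>) * (T powr \<gamma> * ?z) \<le> T powr (k - \<gamma>) * D powr \<gamma>"
      using kp[OF T] by (simp add: mult_ac)
    then have "T powr \<gamma> * ?z \<le> D powr \<gamma>" using T by simp
    then have "?z \<le> D powr \<gamma> / T powr \<gamma>" using T by (simp add: field_simps)
    also have "\<dots> = (D / T) powr \<gamma>" using T D by (simp add: powr_divide)
    also have "D / T = 2 * ?N * C1 / M\<^sup>2 * (1 / T + 1 / r\<^sup>2)" by (simp add: D_def flip: ET)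
    finally show ?thesis .
  qed simp
  show "?z \<le> 2 * (3 + 4 * ?N) * C1 * b\<^sup>2 * (1 / T + 1 / r\<^sup>2)"
  proof (rule ccontr)
    assume "\<not> ?thesis"
    then have "2 * (3 + 4 * ?N) * C1 * b\<^sup>2 * (?E / T) < ?z" unfolding ET by simp
    then have "T ^ k * (2 * (3 + 4 * ?N) * C1 * b\<^sup>2 * (?E / T)) < T ^ k * ?z"
      using T by (intro mult_strict_left_mono zero_less_power)
    moreover have "T ^ (k - 1) * T * (2 * w * C1 * b\<^sup>2 * (e / T)) = w * (2 * C1 * T ^ (k - 1) * e) * b\<^sup>2" for w e
      using T by (simp add: mult_ac)
    moreover have "T ^ k = T ^ (k - 1) * T" using k by (cases k) auto
    \<comment> \<open>Here A = 2 C1 T^(k-1) (1 + T/r^2), twice the largest value that the right side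
      of the estimate can take for \<rho> \<le> T.\<close>
    ultimately have big: "(3 + 4 * ?N) * (2 * C1 * T ^ (k - 1) * ?E) * b\<^sup>2 < T ^ k * ?z"
      by metis
    have "0 \<le> 2 * C1 * T ^ (k - 1) * ?E" using C1_pos T E by simp
    then obtain \<rho> z where \<rho>: "0 < \<rho>" "\<rho> \<le> T" and z: "0 < z"
      and 2: "2 * C1 * T ^ (k - 1) * ?E + M\<^sup>2 / (2 * ?N) * \<rho> ^ k * z powr (q - 1) \<le> C1 * \<rho> ^ (k - 1) * ?E"
      using est[OF _ _ big] by blast
    have "C1 * \<rho> ^ (k - 1) * ?E \<le> C1 * T ^ (k - 1) * ?E"
      using \<rho> C1_pos E by (intro mult_right_mono mult_left_mono power_mono) auto
    moreover have "0 \<le> M\<^sup>2 / (2 * ?N) * \<rho> ^ k * z powr (q - 1)" using \<rho> by simp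
    moreover have "0 < C1 * T ^ (k - 1) * ?E" using C1_pos T E by simp
    moreover have "2 * (C1 * T ^ (k - 1) * ?E) + M\<^sup>2 / (2 * ?N) * \<rho> ^ k * z powr (q - 1) \<le> C1 * \<rho> ^ (k - 1) * ?E"
      using 2 by (simp only: mult.assoc)
    moreover have False if "v \<le> y" "0 \<le> w" "0 < y" "2 * y + w \<le> v" for v w y :: real
      using that by linarith
    ultimately show False by blast
  qed
qed

section \<open>Conversion to the stated rates\<close>

lemma sqrt_sum_inverse_le:
  fixes t R :: real
  assumes "t > 0" "R > 0"
  shows "sqrt (2 / t + 64 / R\<^sup>2) \<le> 8 * (t powr (- (1 / 2)) + 1 / R)"
proof -
  have "sqrt (2 / t + 64 / R\<^sup>2) \<le> sqrt (64 * (1 / t) + 64 * (1 / R\<^sup>2))"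
    using assms by (intro real_sqrt_le_mono add_mono) (auto simp: divide_right_mono)
  also have "\<dots> = sqrt (8\<^sup>2 * (1 / t + 1 / R\<^sup>2))" by (simp add: distrib_left)
  also have "\<dots> = 8 * sqrt (1 / t + 1 / R\<^sup>2)" by (simp only: real_sqrt_mult real_sqrt_abs abs_numeral)
  also have "sqrt (1 / t + 1 / R\<^sup>2) \<le> sqrt (1 / t) + sqrt (1 / R\<^sup>2)"
    using assms by (intro sqrt_add_le_add_sqrt) auto
  also have "sqrt (1 / R\<^sup>2) = 1 / R" using assms by (simp add: real_sqrt_divide)
  also have "sqrt (1 / t) = t powr (- (1 / 2))"
    using assms by (simp add: powr_minus_divide powr_half_sqrt real_sqrt_divide)
  finally show ?thesis by simp
qed

text \<open>The exponent \<gamma>/2 may exceed 1, where powers are not subadditive. The sum is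
  therefore bounded by 128 = 64 + 64 times the larger of 1/t and 1/R^2, and a power of a maximum is
  at most the sum of the powers.\<close>

lemma powr_sum_inverse_le:
  fixes t R D \<gamma> :: real
  assumes "t > 0" "R > 0" "D > 0" "\<gamma> > 0"
  shows "(D * (2 / t + 64 / R\<^sup>2)) powr (\<gamma> / 2) \<le> (128 * D) powr (\<gamma> / 2) * (t powr (- (\<gamma> / 2)) + R powr (- \<gamma>))"
proof -
  define m where "m = max (1 / t) (1 / R\<^sup>2)"
  have m: "m > 0" using assms by (auto simp: m_def less_max_iff_disj)
  have "2 / t \<le> 64 * m" "64 / R\<^sup>2 \<le> 64 * m" using assms by (auto simp: m_def max_def field_simps)
  then have "2 / t + 64 / R\<^sup>2 \<le> 128 * m" by simp
  then have "D * (2 / t + 64 / R\<^sup>2) \<le> 128 * D * m" using assms by simp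
  then have "(D * (2 / t + 64 / R\<^sup>2)) powr (\<gamma> / 2) \<le> (128 * D * m) powr (\<gamma> / 2)"
    using assms by (intro powr_mono2) auto
  also have "\<dots> = (128 * D) powr (\<gamma> / 2) * m powr (\<gamma> / 2)" using assms m by (simp add: powr_mult)
  also have "\<dots> \<le> (128 * D) powr (\<gamma> / 2) * ((1 / t) powr (\<gamma> / 2) + (1 / R\<^sup>2) powr (\<gamma> / 2))"
    by (intro mult_left_mono) (auto simp: m_def max_def)
  also have "(1 / t) powr (\<gamma> / 2) = t powr (- (\<gamma> / 2))"
    using assms by (simp add: powr_divide powr_minus_divide)
  also have "(1 / R\<^sup>2) powr (\<gamma> / 2) = R powr (- \<gamma>)"
  proof -
    have "(R\<^sup>2) powr (\<gamma> / 2) = (R powr 2) powr (\<gamma> / 2)" using assms by simp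
    also have "\<dots> = R powr \<gamma>" by (simp only: powr_powr) simp
    finally show ?thesis using assms by (simp add: powr_divide powr_minus_divide)
  qed
  finally show ?thesis .
qed

theorem theorem1p3:
  fixes p q M :: real
  assumes "p > 1"
    and "q = 2 * p / (p + 1)"
    and "M \<ge> M0 CARD('n) p"
  shows "\<exists>C>0. \<forall>(x0 :: real ^ 'n::finite) R T b u.
    R > 0 \<longrightarrow> T > 0 \<longrightarrow> b \<ge> 1 \<longrightarrow>
    classical_solution p q M (parabolic_cylinder x0 T R) u \<longrightarrow>
    (\<forall>(x, t)\<in>parabolic_cylinder x0 T R. 0 \<le> u x t \<and> u x t \<le> b \<and> dt u x t \<le> 0) \<longrightarrow>
    (\<forall>(x, t)\<in>parabolic_cylinder x0 T (R / 2).
       norm (grad u x t)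
         \<le> C * b * (1 / R + R powr (- ((p + 1) / (p - 1))) + t powr (- ((p + 1) / (2 * p)))))"
proof -
  define \<gamma> where "\<gamma> = (p + 1) / (p - 1)"
  define k where "k = max 2 (nat \<lceil>\<gamma>\<rceil>)"
  define C1 where "C1 = k + 4 * real CARD('n) * k + 64 * (1 + real CARD('n)) * (real k)\<^sup>2"
  define D where "D = 2 * real CARD('n) * C1 / M\<^sup>2"
  define B where "B = 2 * (3 + 4 * real CARD('n)) * C1"
  define C where "C = 8 * sqrt B + (128 * D) powr (\<gamma> / 2)"
  have k: "k \<ge> 2" "\<gamma> \<le> real k" by (auto simp: k_def le_max_iff_disj) linarith
  have \<gamma>: "\<gamma> > 0" using assms(1) by (simp add: \<gamma>_def)
  have C1: "C1 > 0" using k(1) unfolding C1_def by (intro add_pos_nonneg) auto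
  have "0 < M0 CARD('n) p" using assms(1) by (simp add: M0_def)
  with assms(3) have "M > 0" by linarith
  with C1 have D: "D > 0" by (simp add: D_def)
  have B: "B > 0" unfolding B_def using C1 by (intro mult_pos_pos add_pos_nonneg) auto
  have C: "C > 0" unfolding C_def using B by (intro add_pos_nonneg) auto
  have "norm (grad u x t) \<le> C * b * (1 / R + R powr (- \<gamma>) + t powr (- ((p + 1) / (2 * p))))"
    if R: "R > 0" and b: "b \<ge> 1"
      and sol: "classical_solution p q M (parabolic_cylinder x0 T R) u"
      and bounds: "\<forall>(x, t)\<in>parabolic_cylinder x0 T R. 0 \<le> u x t \<and> u x t \<le> b \<and> dt u x t \<le> 0"
      and xt: "(x, t) \<in> parabolic_cylinder x0 T (R / 2)"
    for x0 :: "real ^ 'n" and R T b u x t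
  proof -
    have t: "0 < t" "t < T" and x: "dist x0 x < R / 2" using xt by (auto simp: parabolic_cylinder_def)
    \<comment> \<open>The local estimate is used with r = R/8 on the time interval from t/2 to t:
      the doubled ball has radius R/4 and x is within R/2 of x0.\<close>
    have sub: "cball x (2 * (R / 8)) \<times> {t - t / 2..t} \<subseteq> parabolic_cylinder x0 T R"
    proof -
      have "dist x0 y < R" if "dist x y \<le> R / 4" for y
        using dist_triangle[of x0 y x] x that R by simp
      then show ?thesis using t by (auto simp: parabolic_cylinder_def)
    qed
    have "open (parabolic_cylinder x0 T R)" by (simp add: parabolic_cylinder_def open_Times)
    note est = bernstein_estimates[OF assms this sol _ _ _ sub k(1) \<gamma>_def k(2) C1_def, of b, folded D_def B_def]
    have arg: "1 / (t / 2) + 1 / (R / 8)\<^sup>2 = 2 / t + 64 / R\<^sup>2" by (simp add: power_divide)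
    have "(norm (grad u x t))\<^sup>2 \<le> (D * (2 / t + 64 / R\<^sup>2)) powr \<gamma>"
      using est(1) bounds R t unfolding arg by fastforce
    then have "norm (grad u x t) \<le> sqrt ((D * (2 / t + 64 / R\<^sup>2)) powr \<gamma>)" by (simp add: real_le_rsqrt)
    also have "\<dots> = (D * (2 / t + 64 / R\<^sup>2)) powr (\<gamma> / 2)" by (simp add: powr_powr flip: powr_half_sqrt)
    also have "\<dots> \<le> (128 * D) powr (\<gamma> / 2) * (t powr (- (\<gamma> / 2)) + R powr (- \<gamma>))"
      by (rule powr_sum_inverse_le[OF t(1) R D \<gamma>])
    finally have 1: "norm (grad u x t) \<le> (128 * D) powr (\<gamma> / 2) * (t powr (- (\<gamma> / 2)) + R powr (- \<gamma>))" .
    have "(norm (grad u x t))\<^sup>2 \<le> B * b\<^sup>2 * (2 / t + 64 / R\<^sup>2)"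
      using est(2) bounds R t unfolding arg by fastforce
    then have "norm (grad u x t) \<le> sqrt (B * b\<^sup>2 * (2 / t + 64 / R\<^sup>2))" by (simp add: real_le_rsqrt)
    also have "\<dots> = sqrt B * b * sqrt (2 / t + 64 / R\<^sup>2)" using b by (simp add: real_sqrt_mult)
    also have "\<dots> \<le> sqrt B * b * (8 * (t powr (- (1 / 2)) + 1 / R))"
      using B b by (intro mult_left_mono sqrt_sum_inverse_le t R) auto
    finally have 2: "norm (grad u x t) \<le> 8 * sqrt B * b * (t powr (- (1 / 2)) + 1 / R)" by (simp add: mult_ac)
    let ?S = "1 / R + R powr (- \<gamma>) + t powr (- ((p + 1) / (2 * p)))"
    have S: "0 \<le> ?S" using R by simp
    have C_ge: "8 * sqrt B \<le> C" "(128 * D) powr (\<gamma> / 2) \<le> C" using B by (auto simp: C_def)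
    show "norm (grad u x t) \<le> C * b * ?S"
    \<comment> \<open>As 1/2 \<le> (p+1)/(2p) \<le> \<gamma>/2, the bound with t^(-1/2) suffices for
      t \<le> 1 and the one with t^(-\<gamma>/2) for t > 1; the latter lacks b, which b \<ge> 1
      supplies.\<close>
    proof (cases "t \<le> 1")
      case True
      have "1 / 2 \<le> (p + 1) / (2 * p)" using assms(1) by (simp add: field_simps)
      then have "t powr (- (1 / 2)) \<le> t powr (- ((p + 1) / (2 * p)))" using True t by (intro powr_mono') auto
      then have le: "t powr (- (1 / 2)) + 1 / R \<le> ?S" using powr_ge_zero[of R "- \<gamma>"] by linarith
      note 2
      also have "8 * sqrt B * b * (t powr (- (1 / 2)) + 1 / R) \<le> C * b * ?S"
        using C_ge C b R by (intro mult_mono[OF mult_right_mono le]) auto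
      finally show ?thesis .
    next
      case False
      have "(p + 1) / (2 * p) \<le> \<gamma> / 2" using assms(1) by (simp add: \<gamma>_def divide_simps)
      then have "t powr (- (\<gamma> / 2)) \<le> t powr (- ((p + 1) / (2 * p)))" using False by (intro powr_mono) auto
      then have le: "t powr (- (\<gamma> / 2)) + R powr (- \<gamma>) \<le> ?S" using divide_pos_pos[OF zero_less_one R] by linarith
      note 1
      also have "(128 * D) powr (\<gamma> / 2) * (t powr (- (\<gamma> / 2)) + R powr (- \<gamma>)) \<le> C * ?S"
        using C_ge C by (intro mult_mono le) auto
      also have "\<dots> \<le> C * b * ?S" using mult_right_mono[OF b, of "C * ?S"] C S by (simp add: mult_ac)
      finally show ?thesis .
    qed
  qed
  with C show ?thesis unfolding \<gamma>_def by (intro exI[of _ C]) auto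
qed

end
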